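(* Let $n,p$ be positive integers. The Riemannian manifold $(\mathbb{H}^{n\times n\times p}_{++},g)$, where $g_{\mathcal{P}}(\mathcal{X},\mathcal{Y})=\operatorname{tr}(\mathcal{P}^{-1}*\mathcal{X}*\mathcal{P}^{-1}*\mathcal{Y})$, is (geodesically) complete.
   Context: A tensor $\mathcal{A}\in\mathbb{C}^{m\times n\times p}$ has frontal slices $A^{(1)},\dots,A^{(p)}\in\mathbb{C}^{m\times n}$. $\operatorname{bcirc}(\mathcal{A})\in\mathbb{C}^{mp\times np}$ is the block circulant matrix whose $(j,l)$ block is $A^{(((j-l)\bmod p)+1)}$ (first block column $A^{(1)},\dots,A^{(p)}$); $\operatorname{unfold}(\mathcal{A})$ is the block column $A^{(1)},\dots,A^{(p)}$, and $\operatorname{fold}$ is its inverse. The T-product is $\mathcal{A}*\mathcal{B}=\operatorname{fold}(\operatorname{bcirc}(\mathcal{A})\cdot\operatorname{unfold}(\mathcal{B}))$; inverses are with respect to $*$ and the identity tensor $\mathcal{I}_{n,p}$ (first frontal slice $I_n$, others zero). The T-conjugate transpose $\mathcal{A}^H$ has frontal slices $(A^{(1)})^H,(A^{(p)})^H,\dots,(A^{(2)})^H$. $\mathbb{H}^{n\times n\times p}$ is the real vector space of T-Hermitian tensors ($\mathcal{A}\in\mathbb{C}^{n\times n\times p}$, $\mathcal{A}^H=\mathcal{A}$). With $\langle\mathcal{A},\mathcal{B}\rangle=\sum_{i,j,k}\overline{a_{ijk}}b_{ijk}$, $\mathbb{H}^{n\times n\times p}_{++}$ is the set of T-positive definite tensors,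 i.e. $\mathcal{A}\in\mathbb{H}^{n\times n\times p}$ with $\langle\mathcal{X},\mathcal{A}*\mathcal{X}\rangle>0$ for all nonzero $\mathcal{X}\in\mathbb{C}^{n\times1\times p}$ (equivalently, $\operatorname{bcirc}(\mathcal{A})$ is Hermitian positive definite). It is an open convex cone in $\mathbb{H}^{n\times n\times p}$ (topology of the Frobenius norm), hence a smooth manifold with $T_{\mathcal{P}}\mathbb{H}^{n\times n\times p}_{++}=\mathbb{H}^{n\times n\times p}$. The trace is $\operatorname{tr}(\mathcal{A})=\operatorname{tr}(\operatorname{bcirc}(\mathcal{A}))$. *)

theory Defs
  imports "HOL-Analysis.Analysis"
begin

section \<open>Third-order tensors and the T-product\<close>

text \<open>
  An \<open>m \<times> n \<times> p\<close> tensor is the family of its frontal slices, so \<open>A $ k\<close> is a slice and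
  \<open>A $ k $ i $ j\<close> is the entry \<open>a\<^sub>i\<^sub>j\<^sub>k\<close>. The slices are ordered by the linear order of the
  index type \<^typ>\<open>'p\<close>; as \<^typ>\<open>'p\<close> is finite, this is a numbering by \<open>0, \<dots>, CARD('p) - 1\<close>
  (one less than the usual numbering by \<open>1, \<dots>, p\<close>). Every positive integer is the cardinality
  of such a type, e.g. of the corresponding numeral type.
\<close>

type_synonym ('m, 'n, 'p) tensor = "complex ^ 'n ^ 'm ^ 'p"

definition slice_pos :: "'p::{finite,linorder} \<Rightarrow> nat" where
  "slice_pos k = card {..<k}"

definition slice_at :: "int \<Rightarrow> 'p::{finite,linorder}" where
  "slice_at z = (THE k. int (slice_pos k) = z mod int CARD('p))"

lemma slice_pos_less_iff: "slice_pos j < slice_pos k \<longleftrightarrow> j < k"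
proof -
  have "slice_pos j < slice_pos k" if "j < k" for j k :: 'a
    unfolding slice_pos_def using that
    by (intro psubset_card_mono) (auto simp: psubset_eq set_eq_iff)
  then show ?thesis
    by (metis less_asym neqE)
qed

lemma bij_betw_slice_pos: "bij_betw (slice_pos :: 'p::{finite,linorder} \<Rightarrow> nat) UNIV {..<CARD('p)}"
proof -
  have inj: "inj (slice_pos :: 'p \<Rightarrow> nat)"
    by (metis injI less_irrefl linorder_neqE slice_pos_less_iff)
  have "slice_pos k < CARD('p)" for k :: 'p
    unfolding slice_pos_def by (intro psubset_card_mono) auto
  then have "range (slice_pos :: 'p \<Rightarrow> nat) = {..<CARD('p)}"
    using card_image[OF inj] by (intro card_subset_eq) auto
  with inj show ?thesis
    by (simp add: bij_betw_def)
qed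

lemma slice_pos_slice_at:
  "int (slice_pos (slice_at z :: 'p::{finite,linorder})) = z mod int CARD('p)"
proof -
  let ?r = "nat (z mod int CARD('p))"
  have "?r \<in> range (slice_pos :: 'p \<Rightarrow> nat)"
    using bij_betw_slice_pos[where 'p='p] by (auto simp: bij_betw_def nat_less_iff)
  then obtain k0 :: 'p where "?r = slice_pos k0" ..
  then have k0: "int (slice_pos k0) = z mod int CARD('p)"
    by (metis int_nat_eq pos_mod_sign of_nat_0_less_iff zero_less_card_finite)
  have "k = k0" if "int (slice_pos k) = z mod int CARD('p)" for k :: 'p
    using bij_betw_slice_pos[where 'p='p] that k0
    by (metis bij_betw_def injD of_nat_eq_iff)
  with k0 have "\<exists>!k::'p. int (slice_pos k) = z mod int CARD('p)"
    by blast
  then show ?thesis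
    unfolding slice_at_def by (rule theI')
qed

text \<open>Rows and columns of block matrices are indexed by pairs (block, position in the block).\<close>

definition bcirc :: "('m::finite, 'n::finite, 'p::{finite,linorder}) tensor \<Rightarrow>
    complex ^ ('p \<times> 'n) ^ ('p \<times> 'm)" where
  "bcirc A = (\<chi> r c.
    A $ slice_at (int (slice_pos (fst r)) - int (slice_pos (fst c))) $ snd r $ snd c)"

definition t_unfold :: "('m::finite, 'n::finite, 'p::finite) tensor \<Rightarrow> complex ^ 'n ^ ('p \<times> 'm)" where
  "t_unfold A = (\<chi> r j. A $ fst r $ snd r $ j)"

definition t_fold :: "complex ^ 'n::finite ^ ('p::finite \<times> 'm::finite) \<Rightarrow> ('m, 'n, 'p) tensor" where
  "t_fold M = (\<chi> k i j. M $ (k, i) $ j)"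

definition t_prod ::
  "('m::finite, 'n::finite, 'p) tensor \<Rightarrow> ('n, 's::finite, 'p::{finite,linorder}) tensor \<Rightarrow>
   ('m, 's, 'p) tensor"
  (infixl "\<star>" 70) where
  "A \<star> B = t_fold (bcirc A ** t_unfold B)"

definition t_id :: "('n::finite, 'n, 'p::{finite,linorder}) tensor" where
  "t_id = (\<chi> k. if slice_pos k = 0 then mat 1 else 0)"

definition t_inv :: "('n::finite, 'n, 'p::{finite,linorder}) tensor \<Rightarrow> ('n, 'n, 'p) tensor" where
  "t_inv A = (THE B. A \<star> B = t_id \<and> B \<star> A = t_id)"

definition t_herm :: "('m::finite, 'n::finite, 'p::{finite,linorder}) tensor \<Rightarrow> ('n, 'm, 'p) tensor" where
  "t_herm A = (\<chi> k i j. cnj (A $ slice_at (- int (slice_pos k)) $ j $ i))"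

definition t_inner :: "('m::finite, 'n::finite, 'p::finite) tensor \<Rightarrow> ('m, 'n, 'p) tensor \<Rightarrow> complex" where
  "t_inner A B = (\<Sum>i\<in>UNIV. \<Sum>j\<in>UNIV. \<Sum>k\<in>UNIV. cnj (A $ k $ i $ j) * B $ k $ i $ j)"

definition t_trace :: "('n::finite, 'n, 'p::{finite,linorder}) tensor \<Rightarrow> complex" where
  "t_trace A = trace (bcirc A)"

definition t_hermitian :: "('n::finite, 'n, 'p::{finite,linorder}) tensor set" where
  "t_hermitian = {A. t_herm A = A}"

definition t_pos_def :: "('n::finite, 'n, 'p::{finite,linorder}) tensor set" where
  "t_pos_def = {A \<in> t_hermitian. \<forall>X :: ('n, 1, 'p) tensor. X \<noteq> 0 \<longrightarrow>
     t_inner X (A \<star> X) \<in> \<real> \<and> 0 < Re (t_inner X (A \<star> X))}"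

lemma slice_at_eq_iff:
  "slice_at y = (slice_at z :: 'p::{finite,linorder}) \<longleftrightarrow> y mod int CARD('p) = z mod int CARD('p)"
  using slice_pos_slice_at[of y, where 'p='p] slice_pos_slice_at[of z, where 'p='p]
  unfolding slice_at_def by metis

lemma slice_at_slice_pos: "slice_at (int (slice_pos k)) = (k :: 'p::{finite,linorder})"
proof -
  have "slice_pos k < CARD('p)"
    using bij_betw_slice_pos[where 'p='p] by (auto simp: bij_betw_def)
  then have "slice_pos (slice_at (int (slice_pos k)) :: 'p) = slice_pos k"
    using slice_pos_slice_at[of "int (slice_pos k)", where 'p='p] by simp
  then show ?thesis
    using bij_betw_slice_pos[where 'p='p] by (metis bij_betw_def injD)
qed

lemma slice_at_arith:
  "slice_at (y - int (slice_pos (slice_at z :: 'p))) = (slice_at (y - z) :: 'p::{finite,linorder})"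
  "slice_at (int (slice_pos (slice_at z :: 'p)) - y) = (slice_at (z - y) :: 'p::{finite,linorder})"
  "slice_at (int (slice_pos (slice_at z :: 'p)) + y) = (slice_at (z + y) :: 'p::{finite,linorder})"
  "slice_at (- int (slice_pos (slice_at z :: 'p))) = (slice_at (- z) :: 'p::{finite,linorder})"
  by (simp_all add: slice_at_eq_iff slice_pos_slice_at mod_simps)

lemma sum_UNIV_pair: "sum f (UNIV :: ('a::finite \<times> 'b::finite) set) = (\<Sum>l\<in>UNIV. \<Sum>a\<in>UNIV. f (l, a))"
  by (simp add: sum.cartesian_product)

lemma t_prod_nth: "(A \<star> B) $ k $ i $ j =
  (\<Sum>l\<in>UNIV. \<Sum>a\<in>UNIV. A $ slice_at (int (slice_pos k) - int (slice_pos l)) $ i $ a * B $ l $ a $ j)"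
  by (simp add: t_prod_def t_fold_def t_unfold_def bcirc_def matrix_matrix_mult_def sum_UNIV_pair)

lemma sum_slice_shift:
  fixes f :: "'p::{finite,linorder} \<Rightarrow> complex"
  shows "(\<Sum>l\<in>(UNIV :: 'p set). f (slice_at (int (slice_pos l) - z))) = sum f UNIV"
proof -
  have "bij (\<lambda>l::'p. slice_at (int (slice_pos l) - z) :: 'p)"
    by (rule o_bij[of "\<lambda>l. slice_at (int (slice_pos l) + z)"])
      (simp_all add: fun_eq_iff slice_at_slice_pos slice_at_arith)
  then show ?thesis
    by (rule sum.reindex_bij_betw)
qed

lemma bcirc_t_prod: "bcirc (A \<star> B) = bcirc A ** bcirc B"
  apply (simp add: vec_eq_iff bcirc_def t_prod_nth matrix_matrix_mult_def sum_UNIV_pair)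
  apply (intro allI)
  subgoal for k i l j
    by (subst sum_slice_shift[where z="int (slice_pos l)", symmetric])
       (simp add: slice_at_arith)
  done

lemma bcirc_eq_iff: "bcirc A = bcirc B \<longleftrightarrow> A = B"
proof
  assume eq: "bcirc A = bcirc B"
  have "A $ k $ i $ j = B $ k $ i $ j" for k i j
  proof -
    have "bcirc A $ (k, i) $ (slice_at 0, j) = bcirc B $ (k, i) $ (slice_at 0, j)"
      using eq by simp
    then show ?thesis
      by (simp add: bcirc_def slice_at_arith slice_at_slice_pos)
  qed
  then show "A = B" by (simp add: vec_eq_iff)
qed simp

lemma bcirc_t_id: "bcirc (t_id :: ('n::finite,'n,'p::{finite,linorder}) tensor) = mat 1"
proof -
  have "slice_pos (slice_at (int (slice_pos k) - int (slice_pos l)) :: 'p) = 0 \<longleftrightarrow> k = l" for k l :: 'p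
  proof -
    have "slice_pos (slice_at (int (slice_pos k) - int (slice_pos l)) :: 'p) = 0 \<longleftrightarrow>
      (int (slice_pos k) - int (slice_pos l)) mod int CARD('p) = 0"
      by (metis of_nat_eq_0_iff slice_pos_slice_at)
    also have "\<dots> \<longleftrightarrow> int (slice_pos k) mod int CARD('p) = int (slice_pos l) mod int CARD('p)"
      by (simp add: mod_eq_dvd_iff mod_eq_0_iff_dvd)
    also have "\<dots> \<longleftrightarrow> k = l"
      by (simp add: slice_at_eq_iff[symmetric] slice_at_slice_pos)
    finally show ?thesis .
  qed
  then show ?thesis
    by (simp add: vec_eq_iff bcirc_def t_id_def mat_def)
qed

lemma bcirc_t_herm: "bcirc (t_herm A) $ r $ c = cnj (bcirc A $ c $ r)"
  by (simp add: bcirc_def t_herm_def slice_at_arith)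

lemma t_prod_assoc: "(A \<star> B) \<star> C = A \<star> (B \<star> C)"
  by (simp add: bcirc_eq_iff[symmetric] bcirc_t_prod matrix_mul_assoc)

lemma t_id_left: "t_id \<star> A = A" and t_id_right: "A \<star> t_id = A"
  by (simp_all add: bcirc_eq_iff[symmetric] bcirc_t_prod bcirc_t_id)

lemma t_herm_prod: "t_herm (A \<star> B) = t_herm B \<star> t_herm A"
  by (simp add: bcirc_eq_iff[symmetric] bcirc_t_prod bcirc_t_herm vec_eq_iff
      matrix_matrix_mult_def mult.commute)

lemma t_herm_id: "t_herm t_id = t_id"
  by (auto simp add: bcirc_eq_iff[symmetric] bcirc_t_id bcirc_t_herm vec_eq_iff mat_def)

lemma t_inv_pos_def:
  assumes "P \<in> t_pos_def"
  shows "P \<star> t_inv P = t_id" "t_inv P \<star> P = t_id"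
proof -
  have inj: "X = 0" if "P \<star> X = 0" for X :: "('a,'a,'b) tensor"
  proof (rule ccontr)
    assume "X \<noteq> 0"
    then obtain k i j where nz: "X $ k $ i $ j \<noteq> 0"
      by (auto simp: vec_eq_iff)
    define x :: "('a,1,'b) tensor" where "x = (\<chi> k i _. X $ k $ i $ j)"
    have "P \<star> x = 0"
      using that by (simp add: vec_eq_iff t_prod_nth x_def)
    then have "t_inner x (P \<star> x) = 0" by (simp add: t_inner_def)
    moreover have "x \<noteq> 0" using nz by (auto simp: vec_eq_iff x_def)
    ultimately show False
      using assms by (auto simp: t_pos_def_def)
  qed
  have lin: "linear ((\<star>) P :: ('a,'a,'b) tensor \<Rightarrow> ('a,'a,'b) tensor)"
    by (rule linearI) (simp_all add: vec_eq_iff t_prod_nth distrib_left sum.distrib scaleR_sum_right)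
  then have "surj ((\<star>) P :: ('a,'a,'b) tensor \<Rightarrow> ('a,'a,'b) tensor)"
    using inj by (intro linear_injective_imp_surjective) (simp_all add: linear_injective_0)
  then obtain B where B: "P \<star> B = t_id" by (metis surj_def)
  then have B2: "B \<star> P = t_id"
    using matrix_left_right_inverse[of "bcirc P" "bcirc B"]
    by (simp add: bcirc_eq_iff[symmetric] bcirc_t_prod bcirc_t_id)
  have uniq: "C = B" if "P \<star> C = t_id" for C
  proof -
    have "C = (B \<star> P) \<star> C" by (simp only: B2 t_id_left)
    also have "\<dots> = B" by (simp only: t_prod_assoc that t_id_right)
    finally show ?thesis .
  qed
  have "t_inv P = B"
    unfolding t_inv_def
  proof (rule the_equality)
    show "P \<star> B = t_id \<and> B \<star> P = t_id"
      using B B2 by (rule conjI)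
    show "C = B" if "P \<star> C = t_id \<and> C \<star> P = t_id" for C
      using that by (intro uniq) (rule conjunct1)
  qed
  with B B2 show "P \<star> t_inv P = t_id" "t_inv P \<star> P = t_id"
    by simp_all
qed

lemma t_inv_herm:
  assumes "P \<in> t_pos_def"
  shows "t_herm (t_inv P) = t_inv P"
proof -
  have "t_herm (t_inv P) \<star> t_herm P = t_id"
    by (simp only: t_herm_prod[symmetric] t_inv_pos_def(1)[OF assms] t_herm_id)
  moreover have "t_herm P = P"
    using assms by (simp add: t_pos_def_def t_hermitian_def)
  ultimately have inv: "t_herm (t_inv P) \<star> P = t_id"
    by simp
  have "t_herm (t_inv P) = t_herm (t_inv P) \<star> (P \<star> t_inv P)"
    by (simp only: t_inv_pos_def(1)[OF assms] t_id_right)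
  also have "\<dots> = t_inv P"
    by (simp only: t_prod_assoc[symmetric] inv t_id_left)
  finally show ?thesis .
qed

lemma t_trace_commute: "t_trace (A \<star> B) = t_trace (B \<star> A)"
  unfolding t_trace_def bcirc_t_prod by (rule trace_mul_sym)

lemma t_trace_herm: "t_trace (t_herm A) = cnj (t_trace A)"
  by (simp add: t_trace_def trace_def bcirc_t_herm)

text \<open>
  The trace below is a real number (see \<open>t_metric_real\<close>); \<^const>\<open>Re\<close> only changes its type.
\<close>

definition t_metric :: "('n::finite, 'n, 'p::{finite,linorder}) tensor \<Rightarrow>
    ('n, 'n, 'p) tensor \<Rightarrow> ('n, 'n, 'p) tensor \<Rightarrow> real" where
  "t_metric P X Y = Re (t_trace (t_inv P \<star> X \<star> t_inv P \<star> Y))"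

lemma t_metric_real:
  assumes "P \<in> t_pos_def" "X \<in> t_hermitian" "Y \<in> t_hermitian"
  shows "complex_of_real (t_metric P X Y) = t_trace (t_inv P \<star> X \<star> t_inv P \<star> Y)"
proof -
  let ?R = "t_inv P"
  have "t_herm (?R \<star> X \<star> ?R \<star> Y) = Y \<star> (?R \<star> X \<star> ?R)"
    using assms(2,3) t_inv_herm[OF assms(1)]
    by (simp add: t_herm_prod t_hermitian_def t_prod_assoc)
  then have "cnj (t_trace (?R \<star> X \<star> ?R \<star> Y)) = t_trace (?R \<star> X \<star> ?R \<star> Y)"
    by (metis t_trace_herm t_trace_commute)
  then show ?thesis
    unfolding t_metric_def by (simp add: complex_eq_iff)
qed


section \<open>Riemannian metrics on open subsets of a vector space\<close>

text \<open>
  Below, \<open>U\<close> is a relatively open subset of a linear subspace \<open>V\<close>. It is a manifold with one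
  global chart, whose tangent space at every point is \<open>V\<close>.
\<close>

definition dir_deriv :: "('a::euclidean_space \<Rightarrow> real) \<Rightarrow> 'a \<Rightarrow> 'a \<Rightarrow> real" where
  "dir_deriv f P Z = deriv (\<lambda>t. f (P + t *\<^sub>R Z)) 0"

primrec Ck_on :: "nat \<Rightarrow> 'a::euclidean_space set \<Rightarrow> 'a set \<Rightarrow> ('a \<Rightarrow> real) \<Rightarrow> bool" where
  "Ck_on 0 V U f \<longleftrightarrow> continuous_on U f"
| "Ck_on (Suc k) V U f \<longleftrightarrow> continuous_on U f \<and>
     (\<forall>Z\<in>V. (\<forall>P\<in>U. (\<lambda>t. f (P + t *\<^sub>R Z)) field_differentiable at 0) \<and>
             Ck_on k V U (\<lambda>P. dir_deriv f P Z))"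

definition smooth_fun_on :: "'a::euclidean_space set \<Rightarrow> 'a set \<Rightarrow> ('a \<Rightarrow> real) \<Rightarrow> bool" where
  "smooth_fun_on V U f \<longleftrightarrow> (\<forall>k. Ck_on k V U f)"

definition riemannian_manifold ::
  "'a::euclidean_space set \<Rightarrow> 'a set \<Rightarrow> ('a \<Rightarrow> 'a \<Rightarrow> 'a \<Rightarrow> real) \<Rightarrow> bool" where
  "riemannian_manifold V U g \<longleftrightarrow>
     subspace V \<and> openin (top_of_set V) U \<and>
     (\<forall>P\<in>U.
        (\<forall>X\<in>V. \<forall>Y\<in>V. \<forall>Z\<in>V. \<forall>a b.
           g P (a *\<^sub>R X + b *\<^sub>R Y) Z = a * g P X Z + b * g P Y Z) \<and>
        (\<forall>X\<in>V. \<forall>Y\<in>V. g P X Y = g P Y X) \<and>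
        (\<forall>X\<in>V. X \<noteq> 0 \<longrightarrow> 0 < g P X X)) \<and>
     (\<forall>X\<in>V. \<forall>Y\<in>V. smooth_fun_on V U (\<lambda>P. g P X Y))"

text \<open>
  The Christoffel symbols of the Levi-Civita connection in the global chart: \<open>christoffel V g P X Y\<close>
  is the value at \<open>P\<close> of the covariant derivative of the constant vector field \<open>Y\<close> in direction
  \<open>X\<close>. The equation is the Koszul formula for constant fields, whose Lie brackets vanish.
\<close>

definition christoffel ::
  "'a::euclidean_space set \<Rightarrow> ('a \<Rightarrow> 'a \<Rightarrow> 'a \<Rightarrow> real) \<Rightarrow> 'a \<Rightarrow> 'a \<Rightarrow> 'a \<Rightarrow> 'a" where
  "christoffel V g P X Y = (THE W. W \<in> V \<and> (\<forall>Z\<in>V. 2 * g P W Z =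
     dir_deriv (\<lambda>Q. g Q Y Z) P X + dir_deriv (\<lambda>Q. g Q X Z) P Y - dir_deriv (\<lambda>Q. g Q X Y) P Z))"

text \<open>Covariant derivative along the curve \<open>\<gamma>\<close> of the vector field \<open>W\<close> along \<open>\<gamma>\<close>.\<close>

definition cov_deriv :: "'a::euclidean_space set \<Rightarrow> ('a \<Rightarrow> 'a \<Rightarrow> 'a \<Rightarrow> real) \<Rightarrow>
    (real \<Rightarrow> 'a) \<Rightarrow> (real \<Rightarrow> 'a) \<Rightarrow> real \<Rightarrow> 'a" where
  "cov_deriv V g \<gamma> W t = vector_derivative W (at t) +
     christoffel V g (\<gamma> t) (vector_derivative \<gamma> (at t)) (W t)"

definition smooth_curve_on :: "real set \<Rightarrow> (real \<Rightarrow> 'a::euclidean_space) \<Rightarrow> bool" where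
  "smooth_curve_on I \<gamma> \<longleftrightarrow> (\<exists>D :: nat \<Rightarrow> real \<Rightarrow> 'a. D 0 = \<gamma> \<and>
     (\<forall>k. \<forall>t\<in>I. (D k has_vector_derivative D (Suc k) t) (at t)))"

definition geodesic_on :: "'a::euclidean_space set \<Rightarrow> 'a set \<Rightarrow> ('a \<Rightarrow> 'a \<Rightarrow> 'a \<Rightarrow> real) \<Rightarrow>
    real set \<Rightarrow> (real \<Rightarrow> 'a) \<Rightarrow> bool" where
  "geodesic_on V U g I \<gamma> \<longleftrightarrow>
     open I \<and> is_interval I \<and> I \<noteq> {} \<and> \<gamma> ` I \<subseteq> U \<and> smooth_curve_on I \<gamma> \<and>
     (\<forall>t\<in>I. cov_deriv V g \<gamma> (\<lambda>s. vector_derivative \<gamma> (at s)) t = 0)"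

definition geodesically_complete ::
  "'a::euclidean_space set \<Rightarrow> 'a set \<Rightarrow> ('a \<Rightarrow> 'a \<Rightarrow> 'a \<Rightarrow> real) \<Rightarrow> bool" where
  "geodesically_complete V U g \<longleftrightarrow>
     (\<forall>I \<gamma>. geodesic_on V U g I \<gamma> \<longrightarrow>
        (\<exists>\<eta>. geodesic_on V U g UNIV \<eta> \<and> (\<forall>t\<in>I. \<eta> t = \<gamma> t)))"

end

theory Submission
  imports Defs
begin

text \<open>
  Write \<open>R = t_inv P\<close>. That the tensors form a Riemannian manifold rests on three facts. The inner
  product \<open>A \<bullet> B\<close> is, up to the factor \<open>p\<close>, the real part of the trace of \<open>t_herm A \<star> B\<close>, so that
  \<open>t_metric P X Y\<close> is \<open>p\<close> times \<open>X \<bullet> (R \<star> Y \<star> R)\<close> for T-Hermitian \<open>X\<close> (\<open>t_metric_eq_inner\<close>). The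
  self-adjoint map \<open>X \<mapsto> R \<star> X \<star> R\<close> has a least eigenvalue \<open>\<mu>\<close>, which is positive because its
  eigenvectors \<open>Y\<close> satisfy \<open>R \<star> Y = \<mu> Y \<star> P\<close> (\<open>t_inv_sandwich_pos\<close>). And the metric is built from the
  inverse by sums and products; the derivative of the inverse in direction \<open>Z\<close> is \<open>- R \<star> Z \<star> R\<close>,
  built in the same way, so derivatives of all orders exist (\<open>rational_tensor_map_derivative\<close>).

  Completeness is shown by solving the geodesic equation explicitly. The Koszul formula gives the
  Christoffel symbol \<open>- (X \<star> R \<star> Y + Y \<star> R \<star> X) / 2\<close> (\<open>christoffel_t_metric\<close>), so the geodesic equation
  is \<open>\<gamma>'' = \<gamma>' \<star> t_inv \<gamma> \<star> \<gamma>'\<close>. It says precisely that \<open>A = t_inv \<gamma> \<star> \<gamma>'\<close> is constant, that is,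
  \<open>\<gamma>' = \<gamma> \<star> A\<close>, a linear equation with the solution \<open>\<gamma> t = P \<star> exp ((t - s) A)\<close>, \<open>P = \<gamma> s\<close>, on the whole
  line. What has to be seen is that the solution does not leave the cone: since \<open>P \<star> A\<close> is a velocity,
  it is T-Hermitian, and therefore the solution can be written as the congruence
  \<open>t_herm Y \<star> P \<star> Y\<close> with the invertible tensor \<open>Y = exp ((t - s) A / 2)\<close>
  (\<open>constant_right_velocity_exists\<close>). As solutions of the linear equation with the same initial value
  agree (\<open>constant_right_velocity_unique\<close>), this curve extends \<open>\<gamma>\<close>.
\<close>

section \<open>Self-adjoint maps and linear differential equations\<close>

text \<open>
  The minimum \<open>\<mu>\<close> of the quadratic form \<open>x \<bullet> L x\<close> over the unit sphere is attained by compactness. The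
  form \<open>y \<bullet> L y - \<mu> (y \<bullet> y)\<close> is then nonnegative and vanishes at a minimizer \<open>x\<close>, so its derivative
  at \<open>x\<close> vanishes too, which says \<open>L x = \<mu> x\<close>. In the applications the eigenvector equation
  shows \<open>\<mu> > 0\<close>, so that the quadratic form is positive with a uniform lower bound.
\<close>

lemma self_adjoint_least_eigenvector:
  fixes L :: "'a::euclidean_space \<Rightarrow> 'a"
  assumes "linear L" and sym: "\<And>x y. L x \<bullet> y = x \<bullet> L y"
  shows "\<exists>x \<mu>. x \<noteq> 0 \<and> L x = \<mu> *\<^sub>R x \<and> (\<forall>y. \<mu> * (y \<bullet> y) \<le> y \<bullet> L y)"
proof -
  interpret L: linear L by fact
  have "continuous_on (sphere 0 1) (\<lambda>x. x \<bullet> L x)"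
    by (intro continuous_intros linear_continuous_on)
      (use assms(1) in \<open>simp add: linear_conv_bounded_linear\<close>)
  then obtain x where x: "x \<in> sphere 0 1"
    and min: "\<And>y. y \<in> sphere 0 1 \<Longrightarrow> x \<bullet> L x \<le> y \<bullet> L y"
    using continuous_attains_inf[of "sphere (0::'a) 1" "\<lambda>x. x \<bullet> L x"] by auto
  define \<mu> where "\<mu> = x \<bullet> L x"
  have xx: "x \<bullet> x = 1" using x by (simp add: dot_square_norm)
  have bound: "\<mu> * (y \<bullet> y) \<le> y \<bullet> L y" for y
  proof (cases "y = 0")
    case True
    then show ?thesis by simp
  next
    case False
    have "\<mu> \<le> (y /\<^sub>R norm y) \<bullet> L (y /\<^sub>R norm y)"
      unfolding \<mu>_def using False by (intro min) simp
    also have "\<dots> = (y \<bullet> L y) / (y \<bullet> y)"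
      by (simp add: L.scaleR dot_square_norm power2_eq_square divide_simps)
    finally show ?thesis using False by (simp add: pos_le_divide_eq)
  qed
  \<comment> \<open>Half the gradient of the nonnegative form at its zero \<open>x\<close>: moving from \<open>x\<close> against a
    nonzero \<open>w\<close> by a small step would make the form negative.\<close>
  define w where "w = L x - \<mu> *\<^sub>R x"
  define q where "q = w \<bullet> L w - \<mu> * (w \<bullet> w)"
  have quad: "0 \<le> 2 * t * (w \<bullet> w) + t\<^sup>2 * q" for t
  proof -
    have "0 \<le> (x + t *\<^sub>R w) \<bullet> L (x + t *\<^sub>R w) - \<mu> * ((x + t *\<^sub>R w) \<bullet> (x + t *\<^sub>R w))"
      using bound[of "x + t *\<^sub>R w"] by simp
    also have "\<dots> = (x \<bullet> L x - \<mu> * (x \<bullet> x)) + 2 * t * (w \<bullet> (L x - \<mu> *\<^sub>R x)) + t\<^sup>2 * q"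
      unfolding q_def
      using sym[of x w] inner_commute[of w "L x"] inner_commute[of w x]
      by (simp add: L.add L.scaleR inner_add_left inner_add_right inner_diff_right
          power2_eq_square algebra_simps)
    finally show ?thesis
      by (simp add: \<mu>_def xx w_def)
  qed
  have "w \<bullet> w \<le> 0"
  proof (rule ccontr)
    assume "\<not> w \<bullet> w \<le> 0"
    then have pos: "0 < w \<bullet> w" by linarith
    \<comment> \<open>The denominator makes the second-order term \<open>t * q\<close> smaller than the first-order term.\<close>
    define t where "t = - (w \<bullet> w) / (\<bar>q\<bar> + 1)"
    have "t < 0" unfolding t_def using pos by (auto simp: divide_neg_pos)
    have "0 \<le> t * (2 * (w \<bullet> w) + t * q)"
      using quad[of t] by (simp add: power2_eq_square algebra_simps)
    then have "2 * (w \<bullet> w) + t * q \<le> 0"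
      using \<open>t < 0\<close> by (simp add: zero_le_mult_iff)
    moreover have "\<bar>t * q\<bar> \<le> w \<bullet> w"
    proof -
      have "\<bar>t * q\<bar> = (w \<bullet> w) * (\<bar>q\<bar> / (\<bar>q\<bar> + 1))"
        by (simp add: t_def abs_mult abs_divide)
      also have "\<dots> \<le> (w \<bullet> w) * 1"
        by (intro mult_left_mono) auto
      finally show ?thesis by simp
    qed
    ultimately show False using pos by linarith
  qed
  then have "w \<bullet> w = 0"
    using inner_ge_zero[of w] by linarith
  then have "L x = \<mu> *\<^sub>R x"
    by (simp add: w_def)
  moreover have "x \<noteq> 0" using xx by auto
  ultimately show ?thesis using bound by blast
qed

text \<open>
  The solution is the exponential series \<open>y t = (\<Sum>n. t\<^sup>n / n! L\<^sup>n x)\<close>. Each of its coordinates is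
  a power series with real coefficients that converges everywhere and can be differentiated termwise.
\<close>

lemma linear_ode_solution:
  fixes L :: "'a::euclidean_space \<Rightarrow> 'a"
  assumes "linear L"
  obtains y where "y 0 = x" "\<And>t. (y has_vector_derivative L (y t)) (at t)"
proof -
  have bl: "bounded_linear L" using assms by (simp add: linear_conv_bounded_linear)
  then obtain K where K: "0 \<le> K" "\<And>v. norm (L v) \<le> norm v * K"
    using bounded_linear.nonneg_bounded by blast
  have pow: "norm ((L ^^ n) v) \<le> K ^ n * norm v" for n v
  proof (induction n)
    case (Suc n)
    have "norm ((L ^^ Suc n) v) \<le> norm ((L ^^ n) v) * K"
      using K(2) by simp
    also have "\<dots> \<le> K ^ n * norm v * K"
      using Suc K(1) by (intro mult_right_mono)
    finally show ?case by (simp add: algebra_simps)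
  qed simp
  have summ: "summable (\<lambda>n. (t ^ n / fact n) *\<^sub>R (L ^^ n) v)" for t :: real and v
  proof (rule summable_comparison_test')
    show "summable (\<lambda>n. inverse (fact n) * (\<bar>t\<bar> * K) ^ n * norm v)"
      by (intro summable_mult2 summable_exp)
    show "norm ((t ^ n / fact n) *\<^sub>R (L ^^ n) v) \<le> inverse (fact n) * (\<bar>t\<bar> * K) ^ n * norm v" for n
    proof -
      have "norm ((t ^ n / fact n) *\<^sub>R (L ^^ n) v) = inverse (fact n) * \<bar>t\<bar> ^ n * norm ((L ^^ n) v)"
        by (simp add: power_abs abs_mult divide_inverse)
      also have "\<dots> \<le> inverse (fact n) * \<bar>t\<bar> ^ n * (K ^ n * norm v)"
        by (intro mult_left_mono pow) simp
      finally show ?thesis by (simp add: power_mult_distrib algebra_simps)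
    qed
  qed
  define y where "y t = (\<Sum>n. (t ^ n / fact n) *\<^sub>R (L ^^ n) x)" for t :: real
  have Ly: "L (y t) = (\<Sum>n. (t ^ n / fact n) *\<^sub>R (L ^^ n) (L x))" for t
    unfolding y_def
    by (subst bounded_linear.suminf[OF bl summ])
      (simp add: linear_scale[OF assms] funpow_swap1)
  have inner_y: "(\<Sum>n. (t ^ n / fact n) *\<^sub>R (L ^^ n) v) \<bullet> b = (\<Sum>n. ((L ^^ n) v \<bullet> b / fact n) * t ^ n)"
    for t :: real and v b
    by (subst bounded_linear.suminf[OF bounded_linear_inner_left summ])
      (simp add: mult.commute)
  have "((\<lambda>t. y t \<bullet> b) has_real_derivative L (y t) \<bullet> b) (at t)" for t b
  proof -
    let ?c = "\<lambda>n. (L ^^ n) x \<bullet> b / fact n"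
    have "summable (\<lambda>n. ?c n * s ^ n)" for s
      using bounded_linear.summable[OF bounded_linear_inner_left summ[of s x], of b]
      by (simp add: mult.commute)
    then have "((\<lambda>s. \<Sum>n. ?c n * s ^ n) has_real_derivative (\<Sum>n. diffs ?c n * t ^ n)) (at t)"
      by (rule termdiffs_strong_converges_everywhere)
    moreover have "diffs ?c n = (L ^^ n) (L x) \<bullet> b / fact n" for n
      by (simp add: diffs_def funpow_swap1 divide_simps)
    ultimately show ?thesis
      unfolding Ly by (simp add: inner_y y_def)
  qed
  then have "(y has_vector_derivative L (y t)) (at t)" for t
    unfolding has_vector_derivative_def
    by (subst has_derivative_componentwise_within)
      (simp add: has_field_derivative_def mult_commute_abs)
  moreover have "y 0 = x"
  proof -
    have "y 0 = (\<Sum>n. if n = 0 then x else 0)"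
      unfolding y_def by (intro suminf_cong) auto
    also have "\<dots> = x" using suminf_finite[of "{0::nat}" "\<lambda>n. if n = 0 then x else 0"] by simp
    finally show ?thesis .
  qed
  ultimately show thesis using that by blast
qed

section \<open>The T-product and the real inner product\<close>

lemma bounded_bilinear_t_prod:
  "bounded_bilinear ((\<star>) :: ('m::finite,'n::finite,'p::{finite,linorder}) tensor \<Rightarrow> ('n,'s::finite,'p) tensor \<Rightarrow> _)"
  unfolding bilinear_conv_bounded_bilinear[symmetric] bilinear_def linear_iff
  by (simp add: vec_eq_iff t_prod_nth sum.distrib scaleR_sum_right distrib_left distrib_right)

interpretation t_prod: bounded_bilinear
  "(\<star>) :: ('m::finite,'n::finite,'p::{finite,linorder}) tensor \<Rightarrow> ('n,'s::finite,'p) tensor \<Rightarrow> ('m,'s,'p) tensor"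
  by (rule bounded_bilinear_t_prod)

lemma bounded_linear_t_herm:
  "bounded_linear (t_herm :: ('m::finite,'n::finite,'p::{finite,linorder}) tensor \<Rightarrow> _)"
  unfolding linear_conv_bounded_linear[symmetric] linear_iff
  by (simp add: vec_eq_iff t_herm_def)

lemma t_herm_herm [simp]: "t_herm (t_herm A) = A"
  by (simp add: t_herm_def vec_eq_iff slice_at_arith slice_at_slice_pos)

text \<open>
  Every slice of \<open>A\<close> occurs once in each of the \<open>p\<close> block columns of \<open>bcirc A\<close>; this is the
  factor \<open>p\<close>. Together with the cyclicity of the trace, the identity makes multiplication by \<open>A\<close> and by
  \<open>t_herm A\<close> adjoint maps (\<open>inner_t_prod_left\<close>, \<open>inner_t_prod_right\<close>), so that all computations with
  the metric can be done in the Euclidean space of tensors.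
\<close>

lemma t_trace_herm_prod:
  fixes A B :: "('m::finite,'n::finite,'p::{finite,linorder}) tensor"
  shows "t_trace (t_herm A \<star> B) = of_nat CARD('p) * t_inner A B"
proof -
  define f where "f l = (\<Sum>a\<in>UNIV. \<Sum>i\<in>UNIV. cnj (A $ l $ a $ i) * B $ l $ a $ i)" for l
  have "t_trace (t_herm A \<star> B) =
      (\<Sum>k\<in>(UNIV::'p set). \<Sum>i\<in>UNIV. \<Sum>l\<in>(UNIV::'p set). \<Sum>a\<in>UNIV.
        cnj (A $ slice_at (int (slice_pos l) - int (slice_pos k)) $ a $ i) *
        B $ slice_at (int (slice_pos l) - int (slice_pos k)) $ a $ i)"
    by (simp add: t_trace_def trace_def bcirc_t_prod matrix_matrix_mult_def bcirc_t_herm sum_UNIV_pair)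
      (simp add: bcirc_def)
  also have "\<dots> = (\<Sum>k\<in>(UNIV::'p set). \<Sum>l\<in>(UNIV::'p set). f (slice_at (int (slice_pos l) - int (slice_pos k))))"
    unfolding f_def
    by (subst (2) sum.swap, subst (3) sum.swap) simp
  also have "\<dots> = of_nat CARD('p) * (\<Sum>l\<in>UNIV. f l)"
    by (simp add: sum_slice_shift)
  also have "(\<Sum>l\<in>UNIV. f l) = t_inner A B"
    unfolding f_def t_inner_def by (subst sum.swap, subst (2) sum.swap) simp
  finally show ?thesis .
qed

lemma Re_t_inner: "Re (t_inner A B) = A \<bullet> B"
proof -
  have "Re (t_inner A B) = (\<Sum>i\<in>UNIV. \<Sum>j\<in>UNIV. \<Sum>k\<in>UNIV. A $ k $ i $ j \<bullet> B $ k $ i $ j)"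
    by (simp add: t_inner_def inner_complex_def)
  also have "\<dots> = A \<bullet> B"
    unfolding inner_vec_def by (subst (2) sum.swap, subst sum.swap) simp
  finally show ?thesis .
qed

lemma inner_eq_trace:
  fixes A B :: "('m::finite,'n::finite,'p::{finite,linorder}) tensor"
  shows "Re (t_trace (t_herm A \<star> B)) = CARD('p) * (A \<bullet> B)"
proof -
  have "Re (of_nat n * z) = real n * Re z" for n and z :: complex
    by simp
  then show ?thesis
    by (simp only: t_trace_herm_prod Re_t_inner)
qed

lemma inner_t_prod_left: "(A \<star> B) \<bullet> C = B \<bullet> (t_herm A \<star> C)"
  for B :: "('m::finite,'n::finite,'p::{finite,linorder}) tensor"
proof -
  have "real CARD('p) * ((A \<star> B) \<bullet> C) = real CARD('p) * (B \<bullet> (t_herm A \<star> C))"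
    by (simp only: inner_eq_trace[symmetric] t_herm_prod t_prod_assoc)
  then show ?thesis by simp
qed

lemma inner_t_herm: "t_herm A \<bullet> t_herm B = A \<bullet> B"
  for A B :: "('m::finite,'n::finite,'p::{finite,linorder}) tensor"
proof -
  have "real CARD('p) * (t_herm A \<bullet> t_herm B) = Re (t_trace (A \<star> t_herm B))"
    by (simp only: inner_eq_trace[symmetric] t_herm_herm)
  also have "\<dots> = real CARD('p) * (B \<bullet> A)"
    by (simp only: inner_eq_trace[symmetric] t_trace_commute[of A])
  finally show ?thesis by (simp add: inner_commute)
qed

lemma inner_t_prod_right: "(B \<star> A) \<bullet> C = B \<bullet> (C \<star> t_herm A)"
proof -
  have "(B \<star> A) \<bullet> C = (t_herm A \<star> t_herm B) \<bullet> t_herm C"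
    by (simp only: inner_t_herm[symmetric, of "B \<star> A"] t_herm_prod)
  also have "\<dots> = t_herm B \<bullet> t_herm (C \<star> t_herm A)"
    by (simp only: inner_t_prod_left t_herm_prod t_herm_herm)
  finally show ?thesis by (simp only: inner_t_herm)
qed

lemma t_pos_def_iff:
  "P \<in> t_pos_def \<longleftrightarrow> t_herm P = P \<and> (\<forall>X :: ('n,1,'p) tensor. X \<noteq> 0 \<longrightarrow> 0 < X \<bullet> (P \<star> X))"
  for P :: "('n::finite,'n,'p::{finite,linorder}) tensor"
proof -
  have "t_inner X (P \<star> X) \<in> \<real>" if "t_herm P = P" for X :: "('n,1,'p) tensor"
  proof -
    have "cnj (t_trace (t_herm X \<star> (P \<star> X))) = t_trace (t_herm X \<star> (P \<star> X))"
      unfolding t_trace_herm[symmetric] by (simp add: t_herm_prod that t_prod_assoc)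
    then show ?thesis
      unfolding t_trace_herm_prod by (simp add: Reals_cnj_iff)
  qed
  then show ?thesis
    by (auto simp: t_pos_def_def t_hermitian_def Re_t_inner)
qed

text \<open>
  Positivity on tensors with one column extends to several columns, because multiplication from the
  left acts on each lateral slice \<open>col X j\<close> separately.
\<close>

lemma t_pos_def_inner_pos:
  fixes P :: "('n::finite,'n,'p::{finite,linorder}) tensor" and X :: "('n,'s::finite,'p) tensor"
  assumes "P \<in> t_pos_def" "X \<noteq> 0"
  shows "0 < X \<bullet> (P \<star> X)"
proof -
  define col :: "('n,'s,'p) tensor \<Rightarrow> 's \<Rightarrow> ('n,1,'p) tensor"
    where "col Y j = (\<chi> k i _. Y $ k $ i $ j)" for Y j
  have col_prod: "col (P \<star> X) j = P \<star> col X j" for j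
    by (simp add: col_def vec_eq_iff t_prod_nth)
  have "X \<bullet> (P \<star> X) = (\<Sum>j\<in>UNIV. col X j \<bullet> col (P \<star> X) j)"
    unfolding inner_vec_def col_def
    by (subst sum.swap, subst (2) sum.swap) simp
  also have "\<dots> = (\<Sum>j\<in>UNIV. col X j \<bullet> (P \<star> col X j))"
    by (simp add: col_prod)
  also have "\<dots> > 0"
  proof -
    obtain k i j where "X $ k $ i $ j \<noteq> 0"
      using assms(2) by (auto simp: vec_eq_iff)
    then have "col X j \<noteq> 0" by (auto simp: vec_eq_iff col_def)
    then have "0 < col X j \<bullet> (P \<star> col X j)"
      using assms(1) by (simp add: t_pos_def_iff)
    moreover have "0 \<le> col X j \<bullet> (P \<star> col X j)" for j
      using assms(1) by (cases "col X j = 0") (auto simp: t_pos_def_iff less_imp_le)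
    ultimately show ?thesis
      by (intro sum_pos2[of _ j]) auto
  qed
  finally show ?thesis .
qed

section \<open>The cone of T-positive definite tensors\<close>

lemma subspace_t_hermitian: "subspace (t_hermitian :: ('n::finite,'n,'p::{finite,linorder}) tensor set)"
proof -
  interpret H: bounded_linear "t_herm :: ('n,'n,'p) tensor \<Rightarrow> ('n,'n,'p) tensor"
    by (rule bounded_linear_t_herm)
  show ?thesis
    by (auto simp: subspace_def t_hermitian_def H.add H.scaleR H.zero)
qed

lemma t_pos_def_hermitian: "P \<in> t_pos_def \<Longrightarrow> P \<in> t_hermitian"
  by (simp add: t_pos_def_def)

lemma t_pos_def_inner_lower_bound:
  fixes P :: "('n::finite,'n,'p::{finite,linorder}) tensor"
  assumes "P \<in> t_pos_def"
  obtains \<mu> where "0 < \<mu>" "\<And>X :: ('n,1,'p) tensor. \<mu> * (X \<bullet> X) \<le> X \<bullet> (P \<star> X)"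
proof -
  have herm: "t_herm P = P" using assms by (simp add: t_pos_def_iff)
  have lin: "linear ((\<star>) P :: ('n,1,'p) tensor \<Rightarrow> _)"
    using t_prod.bounded_linear_right by (simp add: linear_conv_bounded_linear)
  have sym: "(P \<star> X) \<bullet> Y = X \<bullet> (P \<star> Y)" for X Y :: "('n,1,'p) tensor"
    by (simp add: inner_t_prod_left herm)
  obtain X :: "('n,1,'p) tensor" and \<mu>
    where X: "X \<noteq> 0" "P \<star> X = \<mu> *\<^sub>R X" and bound: "\<And>Y :: ('n,1,'p) tensor. \<mu> * (Y \<bullet> Y) \<le> Y \<bullet> (P \<star> Y)"
    using self_adjoint_least_eigenvector[OF lin sym] by blast
  have "0 < X \<bullet> (P \<star> X)" using assms X(1) by (rule t_pos_def_inner_pos)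
  then have "0 < \<mu>" using X inner_ge_zero[of X] by (auto simp: zero_less_mult_iff)
  then show thesis using bound that by blast
qed

text \<open>
  The uniform lower bound \<open>\<mu>\<close> of the quadratic form of \<open>P\<close> leaves room for perturbations \<open>Q - P\<close>
  whose quadratic form is smaller than \<open>\<mu>\<close> on the unit sphere.
\<close>

lemma openin_t_pos_def:
  "openin (top_of_set t_hermitian) (t_pos_def :: ('n::finite,'n,'p::{finite,linorder}) tensor set)"
  unfolding openin_euclidean_subtopology_iff
proof (intro conjI ballI)
  show "t_pos_def \<subseteq> (t_hermitian :: ('n,'n,'p) tensor set)"
    by (auto simp: t_pos_def_def)
  fix P :: "('n,'n,'p) tensor" assume P: "P \<in> t_pos_def"
  obtain \<mu> where \<mu>: "0 < \<mu>" "\<And>X :: ('n,1,'p) tensor. \<mu> * (X \<bullet> X) \<le> X \<bullet> (P \<star> X)"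
    using t_pos_def_inner_lower_bound[OF P] by blast
  obtain K where K: "0 < K"
    "\<And>(A :: ('n,'n,'p) tensor) (X :: ('n,1,'p) tensor). norm (A \<star> X) \<le> norm A * norm X * K"
    using t_prod.pos_bounded by blast
  have "Q \<in> t_pos_def" if Q: "Q \<in> t_hermitian" "dist Q P < \<mu> / K" for Q
    unfolding t_pos_def_iff
  proof (intro conjI allI impI)
    show "t_herm Q = Q" using Q(1) by (simp add: t_hermitian_def)
    fix X :: "('n,1,'p) tensor" assume "X \<noteq> 0"
    have "\<bar>X \<bullet> ((Q - P) \<star> X)\<bar> \<le> norm X * (norm (Q - P) * norm X * K)"
      by (rule order_trans[OF Cauchy_Schwarz_ineq2 mult_left_mono[OF K(2) norm_ge_zero]])
    also have "\<dots> = (norm (Q - P) * K) * (X \<bullet> X)"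
      by (simp add: dot_square_norm power2_eq_square)
    also have "\<dots> < \<mu> * (X \<bullet> X)"
      using Q(2) K(1) \<open>X \<noteq> 0\<close> by (intro mult_strict_right_mono) (simp_all add: dist_norm field_simps)
    finally have "\<bar>X \<bullet> ((Q - P) \<star> X)\<bar> < \<mu> * (X \<bullet> X)" .
    moreover have "X \<bullet> (Q \<star> X) = X \<bullet> (P \<star> X) + X \<bullet> ((Q - P) \<star> X)"
      by (simp add: t_prod.diff_left inner_diff_right)
    ultimately show "0 < X \<bullet> (Q \<star> X)"
      using \<mu>(2)[of X] by linarith
  qed
  then show "\<exists>e>0. \<forall>Q\<in>t_hermitian. dist Q P < e \<longrightarrow> Q \<in> t_pos_def"
    using \<mu>(1) K(1) by (intro exI[of _ "\<mu> / K"]) auto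
qed

lemma t_inv_cancel_left:
  assumes "P \<in> t_pos_def"
  shows "P \<star> (t_inv P \<star> X) = X" "t_inv P \<star> (P \<star> X) = X"
  by (simp_all only: t_prod_assoc[symmetric] t_inv_pos_def[OF assms] t_id_left)

lemma t_inv_inner_pos:
  fixes P :: "('n::finite,'n,'p::{finite,linorder}) tensor" and X :: "('n,'s::finite,'p) tensor"
  assumes "P \<in> t_pos_def" "X \<noteq> 0"
  shows "0 < X \<bullet> (t_inv P \<star> X)"
proof -
  define V where "V = t_inv P \<star> X"
  have X: "X = P \<star> V" unfolding V_def using assms(1) by (simp add: t_inv_cancel_left)
  then have "V \<noteq> 0" using assms(2) by (auto simp: t_prod.zero_right)
  then have "0 < V \<bullet> (P \<star> V)" using assms(1) by (intro t_pos_def_inner_pos)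
  also have "V \<bullet> (P \<star> V) = X \<bullet> V"
    by (simp only: X[symmetric] inner_commute)
  finally show ?thesis by (simp only: V_def)
qed

text \<open>
  This is positivity of the metric. The usual argument uses a square root of \<open>P\<close>; here the least
  eigenvector \<open>Y\<close> of the self-adjoint map \<open>X \<mapsto> R X R\<close>, with \<open>R = t_inv P\<close>, is used instead. From
  \<open>R Y R = \<mu> Y\<close> follows \<open>R Y = \<mu> Y P\<close>. Taking the inner product with \<open>Y\<close> gives
  \<open>\<langle>Y, R Y\<rangle> = \<mu> \<langle>Y, Y P\<rangle>\<close>, and both inner products are positive since \<open>R\<close> and \<open>P\<close> are positive
  definite. Hence the least eigenvalue \<open>\<mu>\<close> is positive.
\<close>

lemma t_inv_sandwich_pos:
  fixes P X :: "('n::finite,'n,'p::{finite,linorder}) tensor"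
  assumes P: "P \<in> t_pos_def" and "X \<noteq> 0"
  shows "0 < X \<bullet> (t_inv P \<star> X \<star> t_inv P)"
proof -
  let ?R = "t_inv P"
  have herm: "t_herm ?R = ?R" by (rule t_inv_herm[OF P])
  have lin: "linear (\<lambda>X. ?R \<star> X \<star> ?R)"
    unfolding linear_conv_bounded_linear
    by (intro bounded_linear_compose[OF t_prod.bounded_linear_left] t_prod.bounded_linear_right)
  have sym: "(?R \<star> A \<star> ?R) \<bullet> B = A \<bullet> (?R \<star> B \<star> ?R)" for A B
    by (simp only: inner_t_prod_left[of ?R "A \<star> ?R"] inner_t_prod_right[of A ?R] herm t_prod_assoc)
  obtain Y \<mu>
    where Y: "Y \<noteq> 0" "?R \<star> Y \<star> ?R = \<mu> *\<^sub>R Y" and bound: "\<And>Z. \<mu> * (Z \<bullet> Z) \<le> Z \<bullet> (?R \<star> Z \<star> ?R)"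
    using self_adjoint_least_eigenvector[OF lin sym] by blast
  have YP: "?R \<star> Y = \<mu> *\<^sub>R (Y \<star> P)"
  proof -
    have "?R \<star> Y = (?R \<star> Y \<star> ?R) \<star> P"
      by (simp only: t_prod_assoc t_inv_pos_def[OF P] t_id_right)
    then show ?thesis by (simp only: Y(2) t_prod.scaleR_left)
  qed
  have "0 < Y \<bullet> (?R \<star> Y)"
    using P Y(1) by (rule t_inv_inner_pos)
  also have "\<dots> = \<mu> * (t_herm Y \<bullet> (P \<star> t_herm Y))"
  proof -
    have "Y \<bullet> (Y \<star> P) = t_herm Y \<bullet> (P \<star> t_herm Y)"
      using P inner_t_herm[of Y "Y \<star> P"] by (simp add: t_herm_prod t_pos_def_iff)
    then show ?thesis by (simp add: YP)
  qed
  finally have pos: "0 < \<mu> * (t_herm Y \<bullet> (P \<star> t_herm Y))" .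
  have "t_herm Y \<noteq> 0"
    using Y(1) inner_t_herm[of Y Y] by auto
  then have "0 < t_herm Y \<bullet> (P \<star> t_herm Y)"
    using P by (intro t_pos_def_inner_pos)
  with pos have "0 < \<mu>" by (simp add: zero_less_mult_iff)
  then have "0 < \<mu> * (X \<bullet> X)" using \<open>X \<noteq> 0\<close> by simp
  with bound[of X] show ?thesis by linarith
qed

text \<open>
  The metric is the Euclidean inner product composed with \<open>Y \<mapsto> t_inv P \<star> Y \<star> t_inv P\<close>, up to the factor \<open>p\<close>.
  Since only this map depends on \<open>P\<close>, derivatives of the metric are derivatives of tensor-valued
  functions.
\<close>

lemma t_metric_eq_inner:
  fixes P X Y :: "('n::finite,'n,'p::{finite,linorder}) tensor"
  assumes "X \<in> t_hermitian"
  shows "t_metric P X Y = CARD('p) * (X \<bullet> (t_inv P \<star> Y \<star> t_inv P))"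
proof -
  have "t_trace (t_inv P \<star> (X \<star> t_inv P \<star> Y)) = t_trace (t_herm X \<star> (t_inv P \<star> Y \<star> t_inv P))"
    using assms by (subst t_trace_commute) (simp add: t_hermitian_def t_prod_assoc)
  then show ?thesis
    unfolding t_metric_def inner_eq_trace[symmetric] by (simp add: t_prod_assoc)
qed

lemma t_metric_commute: "t_metric P X Y = t_metric P Y X"
  unfolding t_metric_def
  using t_trace_commute[of "t_inv P \<star> X" "t_inv P \<star> Y"] by (simp only: t_prod_assoc)

lemma t_metric_pos:
  assumes "P \<in> t_pos_def" "X \<in> t_hermitian" "X \<noteq> 0"
  shows "0 < t_metric P X X"
  using t_inv_sandwich_pos[OF assms(1,3)] by (simp add: t_metric_eq_inner[OF assms(2)])

section \<open>Inversion is smooth\<close>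

lemma t_inv_diff:
  assumes P: "P \<in> t_pos_def" and Q: "Q \<in> t_pos_def"
  shows "t_inv Q - t_inv P = - (t_inv Q \<star> (Q - P) \<star> t_inv P)"
proof -
  have "t_inv Q \<star> (Q - P) \<star> t_inv P = t_inv Q \<star> Q \<star> t_inv P - t_inv Q \<star> (P \<star> t_inv P)"
    by (simp only: t_prod.diff_left t_prod.diff_right t_prod_assoc)
  also have "\<dots> = t_inv P - t_inv Q"
    by (simp only: t_inv_pos_def[OF P] t_inv_pos_def[OF Q] t_id_left t_id_right)
  finally show ?thesis by simp
qed

text \<open>
  By \<open>t_inv_diff\<close>, the distance of the inverses is at most \<open>norm (t_inv Q)\<close> times a quantity that
  tends to \<open>0\<close>. Once this quantity is below \<open>1 / 2\<close>, the same estimate bounds \<open>norm (t_inv Q)\<close> by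
  \<open>2 * norm (t_inv P)\<close>.
\<close>

lemma continuous_on_t_inv:
  "continuous_on (t_pos_def :: ('n::finite,'n,'p::{finite,linorder}) tensor set) t_inv"
  unfolding continuous_on_def
proof
  fix P :: "('n,'n,'p) tensor" assume P: "P \<in> t_pos_def"
  obtain K where K: "0 < K"
    "\<And>(A :: ('n,'n,'p) tensor) (B :: ('n,'n,'p) tensor). norm (A \<star> B) \<le> norm A * norm B * K"
    using t_prod.pos_bounded by blast
  let ?r = "norm (t_inv P)" and ?F = "at P within t_pos_def"
  have step: "norm (t_inv Q - t_inv P) \<le> norm (t_inv Q) * (norm (Q - P) * K\<^sup>2 * ?r)"
    if "Q \<in> t_pos_def" for Q
  proof -
    have "norm (t_inv Q - t_inv P) \<le> norm (t_inv Q \<star> (Q - P)) * ?r * K"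
      unfolding t_inv_diff[OF P that] norm_minus_cancel by (rule K(2))
    also have "\<dots> \<le> (norm (t_inv Q) * norm (Q - P) * K) * ?r * K"
      using K by (intro mult_right_mono) auto
    finally show ?thesis by (simp add: power2_eq_square algebra_simps)
  qed
  have lim: "((\<lambda>Q. norm (Q - P) * K\<^sup>2 * ?r) \<longlongrightarrow> 0) ?F"
    by (intro tendsto_eq_intros) auto
  have inU: "\<forall>\<^sub>F Q in ?F. Q \<in> t_pos_def"
    by (simp add: eventually_at_filter)
  have small: "\<forall>\<^sub>F Q in ?F. norm (Q - P) * K\<^sup>2 * ?r < 1 / 2"
    using lim by (rule order_tendstoD) simp
  have "((\<lambda>Q. t_inv Q - t_inv P) \<longlongrightarrow> 0) ?F"
  proof (rule Lim_null_comparison)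
    show "((\<lambda>Q. 2 * ?r * (norm (Q - P) * K\<^sup>2 * ?r)) \<longlongrightarrow> 0) ?F"
      by (rule tendsto_mult_right_zero[OF lim])
    show "\<forall>\<^sub>F Q in ?F. norm (t_inv Q - t_inv P) \<le> 2 * ?r * (norm (Q - P) * K\<^sup>2 * ?r)"
      using inU small
    proof eventually_elim
      case (elim Q)
      have "norm (t_inv Q) \<le> ?r + norm (t_inv Q - t_inv P)"
        by (rule norm_triangle_sub)
      also have "norm (t_inv Q - t_inv P) \<le> norm (t_inv Q) * (1 / 2)"
        by (rule order_trans[OF step[OF elim(1)]]) (use elim(2) in \<open>intro mult_left_mono, auto\<close>)
      finally have "norm (t_inv Q) \<le> 2 * ?r" by simp
      then have "norm (t_inv Q) * (norm (Q - P) * K\<^sup>2 * ?r) \<le> 2 * ?r * (norm (Q - P) * K\<^sup>2 * ?r)"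
        by (rule mult_right_mono) simp
      with step[OF elim(1)] show ?case by (rule order_trans)
    qed
  qed
  then show "(t_inv \<longlongrightarrow> t_inv P) ?F"
    by (simp add: LIM_zero_iff)
qed

lemma has_vector_derivative_iff_quotient:
  "(f has_vector_derivative D) (at t within S) \<longleftrightarrow>
    ((\<lambda>s. (f s - f t) /\<^sub>R (s - t)) \<longlongrightarrow> D) (at t within S)"
proof -
  have "(f has_vector_derivative D) (at t within S) \<longleftrightarrow>
      ((\<lambda>s. norm (f s - f t - (s - t) *\<^sub>R D) / norm (s - t)) \<longlongrightarrow> 0) (at t within S)"
    by (simp add: has_vector_derivative_def has_derivative_iff_norm bounded_linear_scaleR_left)
  also have "\<dots> \<longleftrightarrow> ((\<lambda>s. norm ((f s - f t) /\<^sub>R (s - t) - D)) \<longlongrightarrow> 0) (at t within S)"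
  proof (rule filterlim_cong)
    have "norm (f s - f t - (s - t) *\<^sub>R D) / norm (s - t) = norm ((f s - f t) /\<^sub>R (s - t) - D)"
      if "s \<noteq> t" for s
    proof -
      have "(f s - f t) /\<^sub>R (s - t) - D = (f s - f t - (s - t) *\<^sub>R D) /\<^sub>R (s - t)"
        using that by (simp add: scaleR_diff_right)
      then show ?thesis by (simp add: divide_inverse mult.commute)
    qed
    then show "\<forall>\<^sub>F s in at t within S.
        norm (f s - f t - (s - t) *\<^sub>R D) / norm (s - t) = norm ((f s - f t) /\<^sub>R (s - t) - D)"
      by (simp add: eventually_at_filter)
  qed auto
  also have "\<dots> \<longleftrightarrow> ((\<lambda>s. (f s - f t) /\<^sub>R (s - t)) \<longlongrightarrow> D) (at t within S)"
    by (simp only: tendsto_norm_zero_iff LIM_zero_iff)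
  finally show ?thesis .
qed

text \<open>
  By \<open>t_inv_diff\<close>, the difference quotient of the inverse is minus the product of an inverse, the
  difference quotient of \<open>c\<close> and another inverse; continuity of inversion gives its limit.
\<close>

lemma has_vector_derivative_t_inv:
  assumes c: "(c has_vector_derivative c') (at t within S)" and S: "c ` S \<subseteq> t_pos_def" "t \<in> S"
  shows "((\<lambda>s. t_inv (c s)) has_vector_derivative - (t_inv (c t) \<star> c' \<star> t_inv (c t))) (at t within S)"
  unfolding has_vector_derivative_iff_quotient
proof (rule Lim_transform_eventually)
  have "(c \<longlongrightarrow> c t) (at t within S)"
    using has_vector_derivative_continuous[OF c] by (simp add: continuous_within)
  moreover have "\<forall>\<^sub>F s in at t within S. c s \<in> t_pos_def"
    unfolding eventually_at_filter using S(1) by (intro always_eventually) auto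
  ultimately have inv: "((\<lambda>s. t_inv (c s)) \<longlongrightarrow> t_inv (c t)) (at t within S)"
    using S by (intro continuous_on_tendsto_compose[OF continuous_on_t_inv]) auto
  show "((\<lambda>s. - (t_inv (c s) \<star> ((c s - c t) /\<^sub>R (s - t)) \<star> t_inv (c t))) \<longlongrightarrow>
      - (t_inv (c t) \<star> c' \<star> t_inv (c t))) (at t within S)"
    by (intro tendsto_minus t_prod.tendsto inv tendsto_const
        c[unfolded has_vector_derivative_iff_quotient])
  show "\<forall>\<^sub>F s in at t within S. - (t_inv (c s) \<star> ((c s - c t) /\<^sub>R (s - t)) \<star> t_inv (c t)) =
      (t_inv (c s) - t_inv (c t)) /\<^sub>R (s - t)"
    unfolding eventually_at_filter
  proof (intro always_eventually allI impI)
    fix s assume "s \<in> S"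
    then have "c s \<in> t_pos_def" "c t \<in> t_pos_def" using S by auto
    then show "- (t_inv (c s) \<star> ((c s - c t) /\<^sub>R (s - t)) \<star> t_inv (c t)) =
        (t_inv (c s) - t_inv (c t)) /\<^sub>R (s - t)"
      by (simp add: t_inv_diff t_prod.scaleR_left t_prod.scaleR_right)
  qed
qed

lemma line_stays_in_open_part:
  fixes V :: "'a::euclidean_space set"
  assumes "subspace V" "openin (top_of_set V) U" "P \<in> U" "Z \<in> V"
  obtains e :: real where "0 < e" "\<And>t. \<bar>t\<bar> < e \<Longrightarrow> P + t *\<^sub>R Z \<in> U"
proof -
  obtain T where T: "open T" "U = V \<inter> T"
    using assms(2) by (auto simp: openin_open)
  have "open ((\<lambda>t. P + t *\<^sub>R Z) -` T)"
    by (intro open_vimage T(1) continuous_intros)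
  moreover have "0 \<in> (\<lambda>t. P + t *\<^sub>R Z) -` T"
    using assms(3) T(2) by simp
  ultimately obtain e where "0 < e" "ball 0 e \<subseteq> (\<lambda>t. P + t *\<^sub>R Z) -` T"
    by (rule openE)
  moreover have "P + t *\<^sub>R Z \<in> V" for t
    using assms T(2) by (intro subspace_add subspace_scale) auto
  ultimately show thesis
    using T(2) by (intro that[of e]) (auto simp: subset_iff)
qed

lemma has_vector_derivative_t_inv_line:
  fixes P Z :: "('n::finite,'n,'p::{finite,linorder}) tensor"
  assumes P: "P \<in> t_pos_def" and Z: "Z \<in> t_hermitian"
  shows "((\<lambda>t. t_inv (P + t *\<^sub>R Z)) has_vector_derivative - (t_inv P \<star> Z \<star> t_inv P)) (at 0)"
proof -
  obtain e :: real where e: "0 < e" "\<And>t. \<bar>t\<bar> < e \<Longrightarrow> P + t *\<^sub>R Z \<in> t_pos_def"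
    using line_stays_in_open_part[OF subspace_t_hermitian openin_t_pos_def P Z] by blast
  have "((\<lambda>t. P + t *\<^sub>R Z) has_vector_derivative Z) (at 0 within ball 0 e)"
    by (auto intro!: derivative_eq_intros)
  then have "((\<lambda>t. t_inv (P + t *\<^sub>R Z)) has_vector_derivative
      - (t_inv (P + 0 *\<^sub>R Z) \<star> Z \<star> t_inv (P + 0 *\<^sub>R Z))) (at 0 within ball 0 e)"
    by (rule has_vector_derivative_t_inv) (use e in auto)
  then show ?thesis
    using e(1) by (simp add: at_within_open[of 0 "ball 0 e"])
qed

text \<open>
  A class \<open>C\<close> of continuous functions that contains a directional derivative of each of its members
  consists of smooth functions. The derivatives are only required on \<open>U\<close>, whereas \<^const>\<open>Ck_on\<close>
  differentiates functions on the whole space; the induction therefore runs over all functions that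
  agree on \<open>U\<close> with a member of \<open>C\<close>.
\<close>

lemma smooth_fun_on_coinduct:
  fixes V U :: "'a::euclidean_space set"
  assumes V: "subspace V" and U: "openin (top_of_set V) U"
    and "C f"
    and cont: "\<And>f. C f \<Longrightarrow> continuous_on U f"
    and deriv: "\<And>f Z. C f \<Longrightarrow> Z \<in> V \<Longrightarrow>
      \<exists>f'. C f' \<and> (\<forall>P\<in>U. ((\<lambda>t. f (P + t *\<^sub>R Z)) has_real_derivative f' P) (at 0))"
  shows "smooth_fun_on V U f"
proof -
  have cont_cong: "continuous_on U h" if "C f" "\<And>P. P \<in> U \<Longrightarrow> h P = f P" for f h
    by (rule continuous_on_eq[OF cont[OF that(1)] that(2)[symmetric]])
  have "Ck_on k V U h" if "C f" "\<And>P. P \<in> U \<Longrightarrow> h P = f P" for k f h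
    using that
  proof (induction k arbitrary: f h)
    case 0
    show ?case
      unfolding Ck_on.simps by (rule cont_cong[OF 0])
  next
    case (Suc k)
    have "(\<forall>P\<in>U. (\<lambda>t. h (P + t *\<^sub>R Z)) field_differentiable at 0) \<and>
        Ck_on k V U (\<lambda>P. dir_deriv h P Z)" if Z: "Z \<in> V" for Z
    proof -
      obtain f' where f': "C f'"
        "\<And>P. P \<in> U \<Longrightarrow> ((\<lambda>t. f (P + t *\<^sub>R Z)) has_real_derivative f' P) (at 0)"
        using deriv[OF Suc.prems(1) Z] by blast
      have h': "((\<lambda>t. h (P + t *\<^sub>R Z)) has_real_derivative f' P) (at 0)" if P: "P \<in> U" for P
      proof -
        obtain e :: real where e: "0 < e" "\<And>t. \<bar>t\<bar> < e \<Longrightarrow> P + t *\<^sub>R Z \<in> U"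
          using line_stays_in_open_part[OF V U P Z] by blast
        show ?thesis
          by (rule has_field_derivative_transform_within[OF f'(2)[OF P] e(1)])
            (use e(2) Suc.prems(2) in \<open>auto simp: dist_norm\<close>)
      qed
      then have "dir_deriv h P Z = f' P" if "P \<in> U" for P
        using that by (simp add: dir_deriv_def DERIV_imp_deriv)
      then have "Ck_on k V U (\<lambda>P. dir_deriv h P Z)"
        by (rule Suc.IH[OF f'(1)])
      with h' show ?thesis
        by (auto simp: field_differentiable_def)
    qed
    moreover have "continuous_on U h"
      by (rule cont_cong[OF Suc.prems])
    ultimately show ?case
      unfolding Ck_on.simps by blast
  qed
  then show ?thesis
    using \<open>C f\<close> by (auto simp: smooth_fun_on_def)
qed

text \<open>
  A class of maps closed under directional derivatives in which the metric can be
  written: the derivative of \<^const>\<open>t_inv\<close> in direction \<open>Z\<close> is the product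
  \<open>t_inv P \<star> (- Z) \<star> t_inv P\<close>, a map of the same kind.
\<close>

inductive rational_tensor_map ::
  "(('n::finite,'n,'p::{finite,linorder}) tensor \<Rightarrow> ('n,'n,'p) tensor) \<Rightarrow> bool" where
  const: "rational_tensor_map (\<lambda>P. A)"
| inverse: "rational_tensor_map t_inv"
| add: "rational_tensor_map F \<Longrightarrow> rational_tensor_map G \<Longrightarrow> rational_tensor_map (\<lambda>P. F P + G P)"
| prod: "rational_tensor_map F \<Longrightarrow> rational_tensor_map G \<Longrightarrow> rational_tensor_map (\<lambda>P. F P \<star> G P)"

lemma continuous_on_rational_tensor_map:
  "rational_tensor_map F \<Longrightarrow> continuous_on t_pos_def F"
  by (induction rule: rational_tensor_map.induct)
    (auto intro!: continuous_intros continuous_on_t_inv t_prod.continuous_on)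

lemma rational_tensor_map_derivative:
  assumes "rational_tensor_map F" "Z \<in> t_hermitian"
  shows "\<exists>F'. rational_tensor_map F' \<and>
    (\<forall>P\<in>t_pos_def. ((\<lambda>t. F (P + t *\<^sub>R Z)) has_vector_derivative F' P) (at 0))"
  using assms(1)
proof (induction rule: rational_tensor_map.induct)
  case (const A)
  show ?case
    by (rule exI[of _ "\<lambda>_. 0"]) (auto intro: rational_tensor_map.const)
next
  case inverse
  have "rational_tensor_map (\<lambda>P. t_inv P \<star> (- Z) \<star> t_inv P)"
    by (intro rational_tensor_map.intros)
  moreover have "((\<lambda>t. t_inv (P + t *\<^sub>R Z)) has_vector_derivative t_inv P \<star> (- Z) \<star> t_inv P) (at 0)"
    if "P \<in> t_pos_def" for P
    using has_vector_derivative_t_inv_line[OF that assms(2)]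
    by (simp add: t_prod.minus_left t_prod.minus_right)
  ultimately show ?case by blast
next
  case (add F G)
  then obtain F' G' where "rational_tensor_map F'" "rational_tensor_map G'"
    and "\<forall>P\<in>t_pos_def. ((\<lambda>t. F (P + t *\<^sub>R Z)) has_vector_derivative F' P) (at 0)"
    and "\<forall>P\<in>t_pos_def. ((\<lambda>t. G (P + t *\<^sub>R Z)) has_vector_derivative G' P) (at 0)"
    by blast
  then show ?case
    by (intro exI[of _ "\<lambda>P. F' P + G' P"])
      (auto intro: rational_tensor_map.add has_vector_derivative_add)
next
  case (prod F G)
  then obtain F' G' where F': "rational_tensor_map F'" and G': "rational_tensor_map G'"
    and dF: "\<And>P. P \<in> t_pos_def \<Longrightarrow> ((\<lambda>t. F (P + t *\<^sub>R Z)) has_vector_derivative F' P) (at 0)"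
    and dG: "\<And>P. P \<in> t_pos_def \<Longrightarrow> ((\<lambda>t. G (P + t *\<^sub>R Z)) has_vector_derivative G' P) (at 0)"
    by blast
  have "rational_tensor_map (\<lambda>P. F P \<star> G' P + F' P \<star> G P)"
    using prod.hyps F' G' by (intro rational_tensor_map.add rational_tensor_map.prod)
  moreover have "((\<lambda>t. F (P + t *\<^sub>R Z) \<star> G (P + t *\<^sub>R Z)) has_vector_derivative
      F P \<star> G' P + F' P \<star> G P) (at 0)" if "P \<in> t_pos_def" for P
    using t_prod.has_vector_derivative[OF dF[OF that] dG[OF that]] by simp
  ultimately show ?case by blast
qed

lemma smooth_t_metric:
  fixes X Y :: "('n::finite,'n,'p::{finite,linorder}) tensor"
  assumes "X \<in> t_hermitian"
  shows "smooth_fun_on t_hermitian t_pos_def (\<lambda>P. t_metric P X Y)"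
proof (rule smooth_fun_on_coinduct[where C = "\<lambda>f. \<exists>A F. rational_tensor_map F \<and> f = (\<lambda>P. A \<bullet> F P)",
      OF subspace_t_hermitian openin_t_pos_def])
  have "(\<lambda>P. t_metric P X Y) = (\<lambda>P. (real CARD('p) *\<^sub>R X) \<bullet> (t_inv P \<star> Y \<star> t_inv P))"
    by (simp add: t_metric_eq_inner[OF assms])
  moreover have "rational_tensor_map (\<lambda>P. t_inv P \<star> Y \<star> t_inv P)"
    by (intro rational_tensor_map.intros)
  ultimately show "\<exists>A F. rational_tensor_map F \<and> (\<lambda>P. t_metric P X Y) = (\<lambda>P. A \<bullet> F P)"
    by blast
next
  fix f :: "('n,'n,'p) tensor \<Rightarrow> real"
  assume "\<exists>A F. rational_tensor_map F \<and> f = (\<lambda>P. A \<bullet> F P)"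
  then show "continuous_on t_pos_def f"
    by (auto intro!: continuous_intros continuous_on_rational_tensor_map)
next
  fix f :: "('n,'n,'p) tensor \<Rightarrow> real" and Z :: "('n,'n,'p) tensor"
  assume "\<exists>A F. rational_tensor_map F \<and> f = (\<lambda>P. A \<bullet> F P)" and Z: "Z \<in> t_hermitian"
  then obtain A F where F: "rational_tensor_map F" and f: "f = (\<lambda>P. A \<bullet> F P)" by blast
  obtain F' where F': "rational_tensor_map F'"
    "\<And>P. P \<in> t_pos_def \<Longrightarrow> ((\<lambda>t. F (P + t *\<^sub>R Z)) has_vector_derivative F' P) (at 0)"
    using rational_tensor_map_derivative[OF F Z] by blast
  have "((\<lambda>t. f (P + t *\<^sub>R Z)) has_real_derivative A \<bullet> F' P) (at 0)" if "P \<in> t_pos_def" for P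
    unfolding f has_real_derivative_iff_has_vector_derivative
    by (rule bounded_linear.has_vector_derivative[OF bounded_linear_inner_right F'(2)[OF that]])
  then show "\<exists>f'. (\<exists>A F. rational_tensor_map F \<and> f' = (\<lambda>P. A \<bullet> F P)) \<and>
      (\<forall>P\<in>t_pos_def. ((\<lambda>t. f (P + t *\<^sub>R Z)) has_real_derivative f' P) (at 0))"
    using F'(1) by blast
qed

lemma riemannian_manifold_t_pos_def:
  "riemannian_manifold t_hermitian (t_pos_def :: ('n::finite,'n,'p::{finite,linorder}) tensor set) t_metric"
proof -
  have "t_metric P (a *\<^sub>R X + b *\<^sub>R Y) Z = a * t_metric P X Z + b * t_metric P Y Z"
    if "X \<in> t_hermitian" "Y \<in> t_hermitian" for P X Y Z :: "('n,'n,'p) tensor" and a b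
  proof -
    have "a *\<^sub>R X + b *\<^sub>R Y \<in> t_hermitian"
      using that by (intro subspace_add subspace_scale subspace_t_hermitian)
    then show ?thesis
      using that by (simp add: t_metric_eq_inner inner_add_left algebra_simps)
  qed
  then show ?thesis
    unfolding riemannian_manifold_def
    using subspace_t_hermitian openin_t_pos_def t_metric_commute t_metric_pos smooth_t_metric
    by (intro conjI ballI allI impI)
qed

section \<open>The Levi-Civita connection\<close>

lemma dir_deriv_t_metric:
  fixes P X Y Z :: "('n::finite,'n,'p::{finite,linorder}) tensor"
  assumes P: "P \<in> t_pos_def" and X: "X \<in> t_hermitian" and Z: "Z \<in> t_hermitian"
  defines "R \<equiv> t_inv P"
  shows "dir_deriv (\<lambda>Q. t_metric Q X Y) P Z =
    - (CARD('p) * (X \<bullet> (R \<star> Z \<star> R \<star> Y \<star> R + R \<star> Y \<star> R \<star> Z \<star> R)))"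
proof -
  let ?i = "\<lambda>t. t_inv (P + t *\<^sub>R Z)" and ?D = "- (R \<star> Z \<star> R)"
  have i: "(?i has_vector_derivative ?D) (at 0)"
    unfolding R_def by (rule has_vector_derivative_t_inv_line[OF P Z])
  have "((\<lambda>t. ?i t \<star> Y \<star> ?i t) has_vector_derivative ?i 0 \<star> Y \<star> ?D + (?i 0 \<star> 0 + ?D \<star> Y) \<star> ?i 0) (at 0)"
    by (intro t_prod.has_vector_derivative i has_vector_derivative_const)
  then have "((\<lambda>t. ?i t \<star> Y \<star> ?i t) has_vector_derivative
      - (R \<star> Z \<star> R \<star> Y \<star> R + R \<star> Y \<star> R \<star> Z \<star> R)) (at 0)"
    by (simp add: R_def t_prod.minus_left t_prod.minus_right t_prod.zero_right t_prod_assoc add.commute)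
  then have "((\<lambda>t. CARD('p) * (X \<bullet> (?i t \<star> Y \<star> ?i t))) has_vector_derivative
      CARD('p) * (X \<bullet> (- (R \<star> Z \<star> R \<star> Y \<star> R + R \<star> Y \<star> R \<star> Z \<star> R)))) (at 0)"
    by (intro bounded_linear.has_vector_derivative[OF bounded_linear_mult_right]
        bounded_linear.has_vector_derivative[OF bounded_linear_inner_right])
  then show ?thesis
    unfolding dir_deriv_def t_metric_eq_inner[OF X] has_real_derivative_iff_has_vector_derivative[symmetric]
    by (simp only: DERIV_imp_deriv inner_minus_right mult_minus_right)
qed

lemma t_metric_nondegenerate:
  fixes P V W :: "('n::finite,'n,'p::{finite,linorder}) tensor"
  assumes P: "P \<in> t_pos_def" and V: "V \<in> t_hermitian" and W: "W \<in> t_hermitian"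
    and eq: "\<And>Z. Z \<in> t_hermitian \<Longrightarrow> t_metric P V Z = t_metric P W Z"
  shows "V = W"
proof (rule ccontr)
  assume "V \<noteq> W"
  moreover have VW: "V - W \<in> t_hermitian"
    using V W by (intro subspace_diff subspace_t_hermitian)
  ultimately have "0 < t_metric P (V - W) (V - W)"
    using P by (intro t_metric_pos) auto
  also have "\<dots> = t_metric P V (V - W) - t_metric P W (V - W)"
    by (simp only: t_metric_eq_inner[OF VW] t_metric_eq_inner[OF V] t_metric_eq_inner[OF W]
        inner_diff_left right_diff_distrib)
  also have "\<dots> = 0" using eq[OF VW] by simp
  finally show False by simp
qed

text \<open>
  With \<open>R = t_inv P\<close>, each derivative in the Koszul formula for \<open>X, Y, Z\<close> is a sum of two inner
  products, one for each occurrence of the inverse in the metric. The terms of the derivatives in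
  directions \<open>X\<close> and \<open>Z\<close> cancel, and in the remaining one the factors \<open>R \<star> Y\<close> and \<open>Y \<star> R\<close> move to the
  other side of the inner product as adjoints, leaving
  \<open>- p \<langle>X \<star> R \<star> Y + Y \<star> R \<star> X, R \<star> Z \<star> R\<rangle>\<close>, from which the symbol is read off.
\<close>

lemma christoffel_t_metric:
  fixes P X Y :: "('n::finite,'n,'p::{finite,linorder}) tensor"
  assumes P: "P \<in> t_pos_def" and X: "X \<in> t_hermitian" and Y: "Y \<in> t_hermitian"
  shows "christoffel t_hermitian t_metric P X Y =
    - ((1 / 2) *\<^sub>R (X \<star> t_inv P \<star> Y + Y \<star> t_inv P \<star> X))"
  unfolding christoffel_def
proof (rule the_equality)
  let ?R = "t_inv P" and ?S = "X \<star> t_inv P \<star> Y + Y \<star> t_inv P \<star> X"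
  let ?W = "- ((1 / 2) *\<^sub>R ?S)"
  let ?koszul = "\<lambda>Z. dir_deriv (\<lambda>Q. t_metric Q Y Z) P X + dir_deriv (\<lambda>Q. t_metric Q X Z) P Y -
    dir_deriv (\<lambda>Q. t_metric Q X Y) P Z"
  have R: "t_herm ?R = ?R" by (rule t_inv_herm[OF P])
  have "t_herm ?S = ?S"
    using X Y R
    by (simp add: t_hermitian_def t_herm_prod t_prod_assoc add.commute
        linear_add[OF bounded_linear.linear[OF bounded_linear_t_herm]])
  then have S: "?S \<in> t_hermitian" by (simp add: t_hermitian_def)
  have W: "?W \<in> t_hermitian"
    by (intro subspace_neg subspace_scale subspace_t_hermitian S)
  have koszul: "2 * t_metric P ?W Z = ?koszul Z" if Z: "Z \<in> t_hermitian" for Z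
  proof -
    \<comment> \<open>Putting \<open>Y\<close> first in all inner products makes the cancelling terms equal up to the order of summands.\<close>
    have XY: "(\<lambda>Q. t_metric Q X Y) = (\<lambda>Q. t_metric Q Y X)"
      by (rule ext) (rule t_metric_commute)
    have "Y \<bullet> (?R \<star> X \<star> ?R \<star> Z \<star> ?R + ?R \<star> Z \<star> ?R \<star> X \<star> ?R) =
        Y \<bullet> (?R \<star> Z \<star> ?R \<star> X \<star> ?R + ?R \<star> X \<star> ?R \<star> Z \<star> ?R)"
      by (simp only: add.commute)
    then have "?koszul Z = - (CARD('p) * (X \<bullet> (?R \<star> Y \<star> ?R \<star> Z \<star> ?R + ?R \<star> Z \<star> ?R \<star> Y \<star> ?R)))"
      unfolding XY dir_deriv_t_metric[OF P Y X] dir_deriv_t_metric[OF P X Y] dir_deriv_t_metric[OF P Y Z]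
      by (simp only:)
    also have "X \<bullet> (?R \<star> Y \<star> ?R \<star> Z \<star> ?R + ?R \<star> Z \<star> ?R \<star> Y \<star> ?R) = ?S \<bullet> (?R \<star> Z \<star> ?R)"
    proof -
      have "(Y \<star> ?R \<star> X) \<bullet> (?R \<star> Z \<star> ?R) = X \<bullet> (?R \<star> Y \<star> ?R \<star> Z \<star> ?R)"
        using Y R inner_t_prod_left[of "Y \<star> ?R" X "?R \<star> Z \<star> ?R"]
        by (simp only: t_hermitian_def mem_Collect_eq t_herm_prod t_prod_assoc)
      moreover have "(X \<star> ?R \<star> Y) \<bullet> (?R \<star> Z \<star> ?R) = X \<bullet> (?R \<star> Z \<star> ?R \<star> Y \<star> ?R)"
        using Y R inner_t_prod_right[of X "?R \<star> Y" "?R \<star> Z \<star> ?R"]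
        by (simp only: t_hermitian_def mem_Collect_eq t_herm_prod t_prod_assoc)
      ultimately show ?thesis
        by (simp only: inner_add_left inner_add_right)
    qed
    also have "- (CARD('p) * (?S \<bullet> (?R \<star> Z \<star> ?R))) = 2 * t_metric P ?W Z"
      unfolding t_metric_eq_inner[OF W] by simp
    finally show ?thesis by (rule sym)
  qed
  with W show "?W \<in> t_hermitian \<and> (\<forall>Z\<in>t_hermitian. 2 * t_metric P ?W Z = ?koszul Z)"
    by blast
  show "W = ?W" if "W \<in> t_hermitian \<and> (\<forall>Z\<in>t_hermitian. 2 * t_metric P W Z = ?koszul Z)" for W
  proof -
    have "t_metric P W Z = t_metric P ?W Z" if Z: "Z \<in> t_hermitian" for Z
      using bspec[OF conjunct2[OF \<open>W \<in> t_hermitian \<and> _\<close>] Z] koszul[OF Z] by linarith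
    then show ?thesis
      using that W by (intro t_metric_nondegenerate[OF P]) auto
  qed
qed

lemma velocity_hermitian:
  fixes \<gamma> :: "real \<Rightarrow> ('n::finite,'n,'p::{finite,linorder}) tensor"
  assumes I: "open I" "t \<in> I" and \<gamma>: "\<gamma> ` I \<subseteq> t_hermitian"
    and v: "(\<gamma> has_vector_derivative v) (at t)"
  shows "v \<in> t_hermitian"
proof -
  have "((\<lambda>s. t_herm (\<gamma> s)) has_vector_derivative t_herm v) (at t)"
    by (rule bounded_linear.has_vector_derivative[OF bounded_linear_t_herm v])
  then have "(\<gamma> has_vector_derivative t_herm v) (at t)"
    by (rule has_vector_derivative_transform_within_open[OF _ I])
      (use \<gamma> in \<open>auto simp: t_hermitian_def\<close>)
  then have "t_herm v = v"
    using v by (rule vector_derivative_unique_at)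
  then show ?thesis by (simp add: t_hermitian_def)
qed

text \<open>
  The two terms of the Christoffel symbol coincide for equal arguments, so the geodesic equation is
  \<open>\<gamma>'' = \<gamma>' \<star> t_inv \<gamma> \<star> \<gamma>'\<close>.
\<close>

lemma cov_deriv_velocity:
  fixes \<gamma> v :: "real \<Rightarrow> ('n::finite,'n,'p::{finite,linorder}) tensor"
  assumes I: "open I" "t \<in> I" and \<gamma>: "\<gamma> ` I \<subseteq> t_pos_def"
    and v: "\<And>s. s \<in> I \<Longrightarrow> (\<gamma> has_vector_derivative v s) (at s)"
    and a: "(v has_vector_derivative a) (at t)"
  shows "cov_deriv t_hermitian t_metric \<gamma> (\<lambda>s. vector_derivative \<gamma> (at s)) t =
    a - v t \<star> t_inv (\<gamma> t) \<star> v t"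
proof -
  have velocity: "vector_derivative \<gamma> (at s) = v s" if "s \<in> I" for s
    using v[OF that] by (rule vector_derivative_at)
  have "((\<lambda>s. vector_derivative \<gamma> (at s)) has_vector_derivative a) (at t)"
    by (rule has_vector_derivative_transform_within_open[OF a I]) (simp add: velocity)
  then have acc: "vector_derivative (\<lambda>s. vector_derivative \<gamma> (at s)) (at t) = a"
    by (rule vector_derivative_at)
  have "\<gamma> t \<in> t_pos_def" using I(2) \<gamma> by blast
  moreover have "v t \<in> t_hermitian"
    by (rule velocity_hermitian[OF I _ v[OF I(2)]]) (use \<gamma> t_pos_def_hermitian in blast)
  ultimately show ?thesis
    unfolding cov_deriv_def acc velocity[OF I(2)]
    by (simp add: christoffel_t_metric scaleR_2[symmetric])
qed

section \<open>Geodesics have constant right velocity\<close>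

text \<open>
  If \<open>\<eta>' = \<eta> \<star> A\<close>, then \<open>\<eta>'' = \<eta> \<star> A \<star> A\<close>, which is also the value of \<open>\<eta>' \<star> t_inv \<eta> \<star> \<eta>'\<close>. The
  derivatives of higher order are \<open>\<eta> \<star> A \<star> \<dots> \<star> A\<close>.
\<close>

lemma constant_right_velocity_imp_geodesic:
  fixes \<eta> :: "real \<Rightarrow> ('n::finite,'n,'p::{finite,linorder}) tensor"
  assumes U: "\<And>t. \<eta> t \<in> t_pos_def"
    and d: "\<And>t. (\<eta> has_vector_derivative \<eta> t \<star> A) (at t)"
  shows "geodesic_on t_hermitian t_pos_def t_metric UNIV \<eta>"
proof -
  let ?f = "\<lambda>X. X \<star> A"
  have bl: "bounded_linear (?f ^^ k)" for k
  proof (induction k)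
    case 0
    show ?case by (simp add: id_def bounded_linear_ident)
  next
    case (Suc k)
    show ?case
      using bounded_linear_compose[OF t_prod.bounded_linear_left Suc, of A] by (simp add: o_def)
  qed
  have dk: "((\<lambda>t. (?f ^^ k) (\<eta> t)) has_vector_derivative (?f ^^ Suc k) (\<eta> t)) (at t)" for k t
    using bounded_linear.has_vector_derivative[OF bl[of k] d[of t]]
    unfolding funpow.simps o_def funpow_swap1[of ?f] .
  then have "smooth_curve_on UNIV \<eta>"
    unfolding smooth_curve_on_def
    by (intro exI[of _ "\<lambda>k t. (?f ^^ k) (\<eta> t)"]) auto
  moreover have "cov_deriv t_hermitian t_metric \<eta> (\<lambda>s. vector_derivative \<eta> (at s)) t = 0" for t
  proof -
    have a: "((\<lambda>t. \<eta> t \<star> A) has_vector_derivative \<eta> t \<star> A \<star> A) (at t)"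
      using dk[of 1 t] by simp
    have "cov_deriv t_hermitian t_metric \<eta> (\<lambda>s. vector_derivative \<eta> (at s)) t =
        \<eta> t \<star> A \<star> A - \<eta> t \<star> A \<star> t_inv (\<eta> t) \<star> (\<eta> t \<star> A)"
      using U by (intro cov_deriv_velocity[OF open_UNIV UNIV_I _ d a]) auto
    also have "\<dots> = 0"
      by (simp only: t_prod_assoc t_inv_cancel_left[OF U] diff_self)
    finally show ?thesis .
  qed
  ultimately show ?thesis
    unfolding geodesic_on_def using U by auto
qed

text \<open>
  The derivative of \<open>t_inv \<gamma> \<star> \<gamma>'\<close> is \<open>t_inv \<gamma> \<star> \<gamma>'' - t_inv \<gamma> \<star> \<gamma>' \<star> t_inv \<gamma> \<star> \<gamma>'\<close>, and it vanishes by
  the geodesic equation. The tensor \<open>\<gamma> t \<star> A\<close> is T-Hermitian because it is the velocity of a curve of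
  T-Hermitian tensors; this is what makes the extension of \<open>\<gamma>\<close> T-Hermitian.
\<close>

lemma geodesic_imp_constant_right_velocity:
  fixes \<gamma> :: "real \<Rightarrow> ('n::finite,'n,'p::{finite,linorder}) tensor"
  assumes "geodesic_on t_hermitian t_pos_def t_metric I \<gamma>"
  shows "\<exists>A. \<forall>t\<in>I. \<gamma> t \<star> A \<in> t_hermitian \<and> (\<gamma> has_vector_derivative \<gamma> t \<star> A) (at t)"
proof -
  have I: "open I" "is_interval I" and \<gamma>: "\<gamma> ` I \<subseteq> t_pos_def"
    and cov: "\<And>t. t \<in> I \<Longrightarrow> cov_deriv t_hermitian t_metric \<gamma> (\<lambda>s. vector_derivative \<gamma> (at s)) t = 0"
    and "smooth_curve_on I \<gamma>"
    using assms by (auto simp: geodesic_on_def)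
  then obtain D where D0: "D 0 = \<gamma>"
    and D: "\<And>k t. t \<in> I \<Longrightarrow> (D k has_vector_derivative D (Suc k) t) (at t)"
    unfolding smooth_curve_on_def by blast
  have v: "(\<gamma> has_vector_derivative D 1 t) (at t)" if "t \<in> I" for t
    using D[OF that, of 0] by (simp add: D0)
  have a: "(D 1 has_vector_derivative D 2 t) (at t)" if "t \<in> I" for t
    using D[OF that, of 1] by (simp add: numeral_2_eq_2)
  let ?A = "\<lambda>t. t_inv (\<gamma> t) \<star> D 1 t"
  have v_eq: "D 1 t = \<gamma> t \<star> ?A t" if "t \<in> I" for t
    using \<gamma> that by (subst t_inv_cancel_left) auto
  have "(?A has_vector_derivative 0) (at t within I)" if t: "t \<in> I" for t
  proof -
    have U: "\<gamma> t \<in> t_pos_def" using \<gamma> t by blast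
    have acc: "D 2 t = D 1 t \<star> t_inv (\<gamma> t) \<star> D 1 t"
      using cov[OF t] cov_deriv_velocity[OF I(1) t \<gamma> v a[OF t]] by simp
    have "(?A has_vector_derivative
        t_inv (\<gamma> t) \<star> D 2 t + - (t_inv (\<gamma> t) \<star> D 1 t \<star> t_inv (\<gamma> t)) \<star> D 1 t) (at t within I)"
      by (intro t_prod.has_vector_derivative has_vector_derivative_t_inv
          has_vector_derivative_at_within[OF v[OF t]] has_vector_derivative_at_within[OF a[OF t]] \<gamma> t)
    then show ?thesis
      by (simp add: acc t_prod_assoc t_prod.minus_left)
  qed
  then obtain A where A: "\<And>t. t \<in> I \<Longrightarrow> ?A t = A"
    using has_vector_derivative_zero_constant[of I ?A] I(2) by (auto simp: is_interval_convex)
  have "\<gamma> t \<star> A = D 1 t" if "t \<in> I" for t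
    using v_eq[OF that] A[OF that] by simp
  moreover have "D 1 t \<in> t_hermitian" if "t \<in> I" for t
    using velocity_hermitian[OF I(1) that _ v[OF that]] \<gamma> t_pos_def_hermitian by blast
  ultimately show ?thesis
    using v by (intro exI[of _ A]) simp
qed

text \<open>
  The quotient \<open>\<gamma> \<star> t_inv \<eta>\<close> has derivative \<open>\<gamma> \<star> A \<star> t_inv \<eta> - \<gamma> \<star> t_inv \<eta> \<star> \<eta> \<star> A \<star> t_inv \<eta> = 0\<close>,
  so it remains equal to the identity.
\<close>

lemma constant_right_velocity_unique:
  fixes \<gamma> \<eta> :: "real \<Rightarrow> ('n::finite,'n,'p::{finite,linorder}) tensor"
  assumes I: "is_interval I" "s \<in> I" "t \<in> I"
    and \<gamma>: "\<And>t. t \<in> I \<Longrightarrow> (\<gamma> has_vector_derivative \<gamma> t \<star> A) (at t within I)"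
    and \<eta>: "\<And>t. t \<in> I \<Longrightarrow> (\<eta> has_vector_derivative \<eta> t \<star> A) (at t within I)"
    and U: "\<eta> ` I \<subseteq> t_pos_def" and start: "\<gamma> s = \<eta> s"
  shows "\<gamma> t = \<eta> t"
proof -
  let ?q = "\<lambda>t. \<gamma> t \<star> t_inv (\<eta> t)"
  have "(?q has_vector_derivative 0) (at u within I)" if u: "u \<in> I" for u
  proof -
    have Uu: "\<eta> u \<in> t_pos_def" using U u by blast
    have "(?q has_vector_derivative
        \<gamma> u \<star> - (t_inv (\<eta> u) \<star> (\<eta> u \<star> A) \<star> t_inv (\<eta> u)) + \<gamma> u \<star> A \<star> t_inv (\<eta> u)) (at u within I)"
      by (intro t_prod.has_vector_derivative has_vector_derivative_t_inv \<gamma> \<eta> U u)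
    then show ?thesis
      by (simp add: t_inv_cancel_left[OF Uu] t_prod_assoc t_prod.minus_right)
  qed
  then obtain C where C: "\<And>u. u \<in> I \<Longrightarrow> ?q u = C"
    using has_vector_derivative_zero_constant[of I ?q] I(1) by (auto simp: is_interval_convex)
  have "C = t_id"
    using C[OF I(2)] U I(2) start t_inv_pos_def(1)[of "\<eta> s"] by auto
  then have "\<gamma> t \<star> t_inv (\<eta> t) \<star> \<eta> t = t_id \<star> \<eta> t"
    using C[OF I(3)] by simp
  moreover have "\<eta> t \<in> t_pos_def" using U I(3) by blast
  ultimately show ?thesis
    by (simp only: t_prod_assoc t_inv_pos_def t_id_left t_id_right)
qed

section \<open>Extending geodesics to the whole line\<close>

lemma t_pos_def_congruence:
  fixes P Y F :: "('n::finite,'n,'p::{finite,linorder}) tensor"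
  assumes P: "P \<in> t_pos_def" and F: "F \<star> Y = t_id"
  shows "t_herm Y \<star> P \<star> Y \<in> t_pos_def"
  unfolding t_pos_def_iff
proof (intro conjI allI impI)
  show "t_herm (t_herm Y \<star> P \<star> Y) = t_herm Y \<star> P \<star> Y"
    using P by (simp add: t_herm_prod t_prod_assoc t_pos_def_iff)
  fix X :: "('n,1,'p) tensor" assume "X \<noteq> 0"
  moreover have "X = F \<star> (Y \<star> X)"
    by (simp only: t_prod_assoc[symmetric] F t_id_left)
  ultimately have "Y \<star> X \<noteq> 0"
    by (metis t_prod.zero_right)
  then have "0 < (Y \<star> X) \<bullet> (P \<star> (Y \<star> X))"
    using P by (intro t_pos_def_inner_pos)
  then show "0 < X \<bullet> (t_herm Y \<star> P \<star> Y \<star> X)"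
    by (simp only: inner_t_prod_left t_prod_assoc)
qed

text \<open>
  \<open>Y\<close> is \<open>t \<mapsto> exp (t B)\<close> and \<open>F\<close> is \<open>t \<mapsto> exp (- t B)\<close>. For every \<open>C\<close> that commutes with \<open>B\<close>, the curve
  \<open>Y \<star> C \<star> F\<close> is constant. The case \<open>C = t_id\<close> shows that \<open>F\<close> inverts \<open>Y\<close>, and the case \<open>C = B\<close> that
  \<open>Y\<close> commutes with \<open>B\<close>.
\<close>

lemma one_parameter_group:
  fixes B :: "('n::finite,'n,'p::{finite,linorder}) tensor"
  obtains Y F where "Y 0 = t_id"
    "\<And>t. (Y has_vector_derivative Y t \<star> B) (at t)"
    "\<And>t. F t \<star> Y t = t_id" "\<And>t. Y t \<star> B = B \<star> Y t"
proof -
  have "linear (\<lambda>X. X \<star> B)"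
    using t_prod.bounded_linear_left by (simp add: linear_conv_bounded_linear)
  then obtain Y where Y: "Y 0 = (t_id :: ('n,'n,'p) tensor)"
    "\<And>t. (Y has_vector_derivative Y t \<star> B) (at t)"
    using linear_ode_solution[of "\<lambda>X. X \<star> B" t_id] by blast
  have "linear (\<lambda>X. - B \<star> X)"
    using t_prod.bounded_linear_right by (simp add: linear_conv_bounded_linear)
  then obtain F where F: "F 0 = (t_id :: ('n,'n,'p) tensor)"
    "\<And>t. (F has_vector_derivative - B \<star> F t) (at t)"
    using linear_ode_solution[of "\<lambda>X. - B \<star> X" t_id] by blast
  have const: "Y t \<star> C \<star> F t = C" if C: "B \<star> C = C \<star> B" for t C
  proof -
    have "((\<lambda>t. Y t \<star> C \<star> F t) has_vector_derivative 0) (at t)" for t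
    proof -
      have "((\<lambda>t. Y t \<star> C \<star> F t) has_vector_derivative
          Y t \<star> C \<star> (- B \<star> F t) + (Y t \<star> 0 + Y t \<star> B \<star> C) \<star> F t) (at t)"
        by (intro t_prod.has_vector_derivative Y F has_vector_derivative_const)
      moreover have "Y t \<star> C \<star> (- B \<star> F t) + (Y t \<star> 0 + Y t \<star> B \<star> C) \<star> F t =
          Y t \<star> (B \<star> C) \<star> F t - Y t \<star> (C \<star> B) \<star> F t"
        by (simp add: t_prod.minus_left t_prod.minus_right t_prod.zero_right t_prod_assoc)
      ultimately show ?thesis by (simp add: C)
    qed
    then obtain c where "\<And>t. Y t \<star> C \<star> F t = c"
      using has_vector_derivative_zero_constant[of UNIV "\<lambda>t. Y t \<star> C \<star> F t"] by auto
    moreover have "Y 0 \<star> C \<star> F 0 = C"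
      by (simp only: Y F t_id_left t_id_right)
    ultimately show ?thesis by metis
  qed
  have YF: "Y t \<star> F t = t_id" for t
    using const[of t_id t] by (simp add: t_id_left t_id_right)
  have FY: "F t \<star> Y t = t_id" for t
    using YF[of t] matrix_left_right_inverse[of "bcirc (Y t)" "bcirc (F t)"]
    by (simp add: bcirc_eq_iff[symmetric] bcirc_t_prod bcirc_t_id)
  have "Y t \<star> B = B \<star> Y t" for t
  proof -
    have "Y t \<star> B = Y t \<star> B \<star> (F t \<star> Y t)"
      by (simp only: FY t_id_right)
    also have "\<dots> = (Y t \<star> B \<star> F t) \<star> Y t"
      by (simp only: t_prod_assoc)
    finally show ?thesis by (simp only: const)
  qed
  with Y FY show thesis by (rule that)
qed

text \<open>
  The solution should be \<open>P \<star> exp (t A)\<close>, for which positivity is not apparent. As \<open>P \<star> A\<close> is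
  T-Hermitian, \<open>t_herm A \<star> P = P \<star> A\<close>; so half of the exponential can be moved across \<open>P\<close>, which gives
  \<open>t_herm Y \<star> P \<star> Y\<close> with \<open>Y = exp (t A / 2)\<close>. In this form the solution is congruent to \<open>P\<close> and thus
  T-positive definite for all \<open>t\<close>.
\<close>

lemma constant_right_velocity_exists:
  fixes P A :: "('n::finite,'n,'p::{finite,linorder}) tensor"
  assumes P: "P \<in> t_pos_def" and PA: "P \<star> A \<in> t_hermitian"
  obtains \<eta> where "\<eta> s = P" "\<And>t. \<eta> t \<in> t_pos_def"
    "\<And>t. (\<eta> has_vector_derivative \<eta> t \<star> A) (at t)"
proof -
  define B where "B = (1 / 2 :: real) *\<^sub>R A"
  obtain Y F where Y: "Y 0 = t_id" "\<And>t. (Y has_vector_derivative Y t \<star> B) (at t)"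
    "\<And>t. F t \<star> Y t = t_id" "\<And>t. Y t \<star> B = B \<star> Y t"
    using one_parameter_group[of B] by blast
  define G where "G t = t_herm (Y t) \<star> P \<star> Y t" for t
  have "P \<star> B \<in> t_hermitian"
    unfolding B_def t_prod.scaleR_right by (intro subspace_scale subspace_t_hermitian PA)
  then have PB: "t_herm B \<star> P = P \<star> B"
    using P by (simp add: t_hermitian_def t_pos_def_iff t_herm_prod)
  have dG: "(G has_vector_derivative G t \<star> A) (at t)" for t
  proof -
    have YB: "t_herm (Y t \<star> B) = t_herm (Y t) \<star> t_herm B"
      unfolding Y(4) by (rule t_herm_prod)
    have "(G has_vector_derivative t_herm (Y t) \<star> P \<star> (Y t \<star> B) +
        (t_herm (Y t) \<star> 0 + t_herm (Y t \<star> B) \<star> P) \<star> Y t) (at t)"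
      unfolding G_def
      by (intro t_prod.has_vector_derivative Y has_vector_derivative_const
          bounded_linear.has_vector_derivative[OF bounded_linear_t_herm])
    moreover have "t_herm (Y t) \<star> P \<star> (Y t \<star> B) + (t_herm (Y t) \<star> 0 + t_herm (Y t \<star> B) \<star> P) \<star> Y t = G t \<star> A"
    proof -
      have "t_herm (Y t \<star> B) \<star> P \<star> Y t = t_herm (Y t) \<star> (t_herm B \<star> P) \<star> Y t"
        by (simp only: YB t_prod_assoc)
      also have "\<dots> = t_herm (Y t) \<star> P \<star> (B \<star> Y t)"
        by (simp only: PB t_prod_assoc)
      also have "\<dots> = G t \<star> B"
        by (simp only: Y(4)[symmetric] G_def t_prod_assoc)
      finally have "t_herm (Y t) \<star> P \<star> (Y t \<star> B) + (t_herm (Y t) \<star> 0 + t_herm (Y t \<star> B) \<star> P) \<star> Y t =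
          G t \<star> B + G t \<star> B"
        by (simp only: t_prod.zero_right add_0_left) (simp only: G_def t_prod_assoc)
      also have "\<dots> = G t \<star> A"
        by (simp add: B_def t_prod.scaleR_right scaleR_left_distrib[symmetric])
      finally show ?thesis .
    qed
    ultimately show ?thesis by simp
  qed
  show thesis
  proof (rule that[of "\<lambda>t. G (t - s)"])
    show "G (s - s) = P"
      by (simp add: G_def Y(1) t_herm_id t_id_left t_id_right)
    show "G (t - s) \<in> t_pos_def" for t
      unfolding G_def by (rule t_pos_def_congruence[OF P Y(3)])
    show "((\<lambda>t. G (t - s)) has_vector_derivative G (t - s) \<star> A) (at t)" for t
      using vector_diff_chain_at[of "\<lambda>t. t - s" 1 t G, OF _ dG]
      by (simp add: o_def has_vector_derivative_diff_const)
  qed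
qed

section \<open>Completeness of the cone\<close>

theorem corollary4p3:
  shows "riemannian_manifold t_hermitian
           (t_pos_def :: ('n::finite, 'n, 'p::{finite,linorder}) tensor set) t_metric
       \<and> geodesically_complete t_hermitian
           (t_pos_def :: ('n, 'n, 'p) tensor set) t_metric"
proof
  show "riemannian_manifold t_hermitian (t_pos_def :: ('n, 'n, 'p) tensor set) t_metric"
    by (rule riemannian_manifold_t_pos_def)
  show "geodesically_complete t_hermitian (t_pos_def :: ('n, 'n, 'p) tensor set) t_metric"
    unfolding geodesically_complete_def
  proof (intro allI impI)
    fix I and \<gamma> :: "real \<Rightarrow> ('n,'n,'p) tensor"
    assume geo: "geodesic_on t_hermitian t_pos_def t_metric I \<gamma>"
    then obtain s where s: "s \<in> I" and int: "is_interval I" and U: "\<gamma> ` I \<subseteq> t_pos_def"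
      by (auto simp: geodesic_on_def)
    obtain A where A: "\<And>t. t \<in> I \<Longrightarrow> \<gamma> t \<star> A \<in> t_hermitian"
      and d\<gamma>: "\<And>t. t \<in> I \<Longrightarrow> (\<gamma> has_vector_derivative \<gamma> t \<star> A) (at t)"
      using geodesic_imp_constant_right_velocity[OF geo] by blast
    have Ps: "\<gamma> s \<in> t_pos_def" using U s by blast
    obtain \<eta> where \<eta>: "\<eta> s = \<gamma> s" "\<And>t. \<eta> t \<in> t_pos_def"
      "\<And>t. (\<eta> has_vector_derivative \<eta> t \<star> A) (at t)"
      using constant_right_velocity_exists[OF Ps A[OF s], of s] by blast
    have "\<eta> t = \<gamma> t" if "t \<in> I" for t
      by (rule constant_right_velocity_unique[OF int s that, of \<gamma> A \<eta>, symmetric])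
        (use \<eta> d\<gamma> in \<open>auto intro: has_vector_derivative_at_within\<close>)
    moreover have "geodesic_on t_hermitian t_pos_def t_metric UNIV \<eta>"
      by (rule constant_right_velocity_imp_geodesic[OF \<eta>(2,3)])
    ultimately show "\<exists>\<eta>. geodesic_on t_hermitian t_pos_def t_metric UNIV \<eta> \<and> (\<forall>t\<in>I. \<eta> t = \<gamma> t)"
      by blast
  qed
qed

end
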